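(* Let $0<\alpha<2$ and $K>0$. For any $\varepsilon\in(0,1)$ there exists a constant $C>0$ depending only on $\alpha$, $K$ and $\varepsilon$ such that, for all integers $n\ge2$, $p\ge1$ and $s\in[p]$, with $$t^{\mathrm{res}}=32\bigl\{\log(e^2p/s)+s^{-1}\log\log(8n)\bigr\},$$ there exists a test $\phi_{\mathcal{G},\mathrm{sparse}}^{\mathrm{res}}$ such that $$\mathcal{R}_{\mathcal{Q},\mathrm{res}}(\rho,\phi_{\mathcal{G},\mathrm{sparse}}^{\mathrm{res}})\le\varepsilon\qquad(\mathcal{Q}=\mathcal{G}_{\alpha,K}^{\otimes})$$ as long as $$\rho^2\ge C\bigl\{s\log(ep/s)+\log\log(8n)\bigr\}.$$
   Context: Notation: $[m]=\{1,\dots,m\}$; $\log$ is the natural logarithm; $\|v\|_0$ is the number of nonzero entries of $v$. Model: $X=\theta+E\in\mathbb{R}^{p\times n}$, with deterministic $\theta$ and random $E\sim P_e$; $\theta_t\in\mathbb{R}^p$ denotes the $t$-th column. $\mathbb{E}_{\theta,P_e}$ is expectation under the law of $X$. A test is a measurable map $\phi:\mathbb{R}^{p\times n}\to\{0,1\}$. Null space: $\Theta_0(p,n)=\{\theta:\exists\mu\in\mathbb{R}^p,\ \theta_t=\mu\ \forall t\in[n]\}$. For $t_0\in[n-1]$, $\Theta^{(t_0)}(p,n,s,\rho)$ is the set of $\theta$ for which there are $\mu_1,\mu_2\in\mathbb{R}^p$ with $\theta_t=\mu_1$ for $t\le t_0$, $\theta_t=\mu_2$ for $t>t_0$, $\|\mu_1-\mu_2\|_0\le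 s$ and $\frac{t_0(n-t_0)}{n}\|\mu_1-\mu_2\|_2^2\ge\rho^2$. Restricted alternative space: $\Theta_{\mathrm{res}}(p,n,s,\rho)=\bigcup_{t_0}\Theta^{(t_0)}(p,n,s,\rho)$, the union over integers $t_0$ with $t^{\mathrm{res}}+1\le t_0\le n-t^{\mathrm{res}}$ (a supremum over an empty set is $0$). Noise class: $\mathcal{G}_{\alpha,K}$ is the class of distributions of real random variables $W$ with $\mathbb{E}W=0$, $\mathbb{E}W^2=1$, $\mathbb{E}\exp(|W/K|^\alpha)\le2$. $\mathcal{G}_{\alpha,K}^{\otimes}$ is the class of joint distributions of $E$ with mutually independent entries, each entry having a (possibly different) distribution in $\mathcal{G}_{\alpha,K}$. Worst-case testing error: $$\mathcal{R}_{\mathcal{Q},\mathrm{res}}(\rho,\phi)=\sup_{P_e\in\mathcal{Q}}\sup_{\theta\in\Theta_0(p,n)}\mathbb{E}_{\theta,P_e}(\phi)+\sup_{P_e\in\mathcal{Q}}\sup_{\theta\in\Theta_{\mathrm{res}}(p,n,s,\rho)}\mathbb{E}_{\theta,P_e}(1-\phi).$$ *)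

theory Defs
  imports "HOL-Probability.Probability"
begin

text \<open>
  The dimensions p and n vary inside the statement, so vectors and matrices are extensional
  functions on explicit index sets. The entry in row i and column t of a matrix x is x (i, t),
  with i in 1..p and t in 1..n.
\<close>

definition vectors :: "nat \<Rightarrow> (nat \<Rightarrow> real) set" where
  "vectors p = {1..p} \<rightarrow>\<^sub>E UNIV"

definition entries :: "nat \<Rightarrow> nat \<Rightarrow> (nat \<times> nat) set" where
  "entries p n = {1..p} \<times> {1..n}"

definition mat_space :: "nat \<Rightarrow> nat \<Rightarrow> (nat \<times> nat \<Rightarrow> real) measure" where
  "mat_space p n = (\<Pi>\<^sub>M k\<in>entries p n. borel)"

definition mat_add ::
  "nat \<Rightarrow> nat \<Rightarrow> (nat \<times> nat \<Rightarrow> real) \<Rightarrow> (nat \<times> nat \<Rightarrow> real) \<Rightarrow> (nat \<times> nat \<Rightarrow> real)" where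
  "mat_add p n x y = (\<lambda>k\<in>entries p n. x k + y k)"

definition column :: "nat \<Rightarrow> (nat \<times> nat \<Rightarrow> real) \<Rightarrow> nat \<Rightarrow> (nat \<Rightarrow> real)" where
  "column p x t = (\<lambda>i\<in>{1..p}. x (i, t))"

definition l0_norm :: "nat \<Rightarrow> (nat \<Rightarrow> real) \<Rightarrow> nat" where
  "l0_norm p v = card {i \<in> {1..p}. v i \<noteq> 0}"

definition l2_norm :: "nat \<Rightarrow> (nat \<Rightarrow> real) \<Rightarrow> real" where
  "l2_norm p v = L2_set v {1..p}"

definition Theta_null :: "nat \<Rightarrow> nat \<Rightarrow> (nat \<times> nat \<Rightarrow> real) set" where
  "Theta_null p n =
     {\<theta> \<in> space (mat_space p n). \<exists>\<mu>\<in>vectors p. \<forall>t\<in>{1..n}. column p \<theta> t = \<mu>}"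

definition Theta_at ::
  "nat \<Rightarrow> nat \<Rightarrow> nat \<Rightarrow> nat \<Rightarrow> real \<Rightarrow> (nat \<times> nat \<Rightarrow> real) set" where
  "Theta_at t0 p n s \<rho> =
     {\<theta> \<in> space (mat_space p n). \<exists>\<mu>1\<in>vectors p. \<exists>\<mu>2\<in>vectors p.
        (\<forall>t\<in>{1..t0}. column p \<theta> t = \<mu>1) \<and>
        (\<forall>t\<in>{t0<..n}. column p \<theta> t = \<mu>2) \<and>
        l0_norm p (\<lambda>i. \<mu>1 i - \<mu>2 i) \<le> s \<and>
        real t0 * (real n - real t0) / real n * (l2_norm p (\<lambda>i. \<mu>1 i - \<mu>2 i))\<^sup>2 \<ge> \<rho>\<^sup>2}"

definition t_res :: "nat \<Rightarrow> nat \<Rightarrow> nat \<Rightarrow> real" where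
  "t_res p n s =
     32 * (ln ((exp 1)\<^sup>2 * real p / real s) + inverse (real s) * ln (ln (8 * real n)))"

definition Theta_res ::
  "nat \<Rightarrow> nat \<Rightarrow> nat \<Rightarrow> real \<Rightarrow> (nat \<times> nat \<Rightarrow> real) set" where
  "Theta_res p n s \<rho> =
     (\<Union>t0 \<in> {t0 \<in> {1..n - 1}. t_res p n s + 1 \<le> real t0 \<and> real t0 \<le> real n - t_res p n s}.
        Theta_at t0 p n s \<rho>)"

definition noise_class :: "real \<Rightarrow> real \<Rightarrow> real measure set" where
  "noise_class \<alpha> K =
     {\<nu>. prob_space \<nu> \<and> sets \<nu> = sets borel \<and>
        integrable \<nu> (\<lambda>w. w) \<and> (\<integral>w. w \<partial>\<nu>) = 0 \<and>
        integrable \<nu> (\<lambda>w. w\<^sup>2) \<and> (\<integral>w. w\<^sup>2 \<partial>\<nu>) = 1 \<and>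
        (\<integral>\<^sup>+w. ennreal (exp (\<bar>w / K\<bar> powr \<alpha>)) \<partial>\<nu>) \<le> 2}"

definition indep_noise_class ::
  "real \<Rightarrow> real \<Rightarrow> nat \<Rightarrow> nat \<Rightarrow> (nat \<times> nat \<Rightarrow> real) measure set" where
  "indep_noise_class \<alpha> K p n =
     {P. prob_space P \<and> sets P = sets (mat_space p n) \<and>
        prob_space.indep_vars P (\<lambda>k. borel) (\<lambda>k e. e k) (entries p n) \<and>
        (\<forall>k\<in>entries p n. distr P borel (\<lambda>e. e k) \<in> noise_class \<alpha> K)}"

definition data_law ::
  "nat \<Rightarrow> nat \<Rightarrow> (nat \<times> nat \<Rightarrow> real) \<Rightarrow> (nat \<times> nat \<Rightarrow> real) measure
     \<Rightarrow> (nat \<times> nat \<Rightarrow> real) measure" where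
  "data_law p n \<theta> P = distr P (mat_space p n) (\<lambda>e. mat_add p n \<theta> e)"

definition is_test :: "nat \<Rightarrow> nat \<Rightarrow> ((nat \<times> nat \<Rightarrow> real) \<Rightarrow> real) \<Rightarrow> bool" where
  "is_test p n \<phi> \<longleftrightarrow> \<phi> \<in> mat_space p n \<rightarrow>\<^sub>M count_space {0, 1}"

text \<open>
  Errors are valued in ennreal, where the supremum of the empty set is 0. This matters when the
  noise class is empty (K too small) or when no change point t0 is admissible.
\<close>

definition worst_case_error ::
  "(nat \<times> nat \<Rightarrow> real) measure set \<Rightarrow> nat \<Rightarrow> nat \<Rightarrow> nat \<Rightarrow> real
     \<Rightarrow> ((nat \<times> nat \<Rightarrow> real) \<Rightarrow> real) \<Rightarrow> ennreal" where
  "worst_case_error Q p n s \<rho> \<phi> =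
     (SUP P\<in>Q. SUP \<theta>\<in>Theta_null p n. \<integral>\<^sup>+x. ennreal (\<phi> x) \<partial>data_law p n \<theta> P) +
     (SUP P\<in>Q. SUP \<theta>\<in>Theta_res p n s \<rho>. \<integral>\<^sup>+x. ennreal (1 - \<phi> x) \<partial>data_law p n \<theta> P)"

end

theory Submission
  imports Defs
begin

text \<open>
  Only the unit variance of the noise is used. Let \<open>Z (i, j) = X (i, j) - X (i, n + 1 - j)\<close>
  for \<open>j \<le> n div 2\<close>. Under the null these are independent and centred with variance 2, so
  for every array of tilts \<open>l\<close> the product of \<open>(1 + l Z + (l Z)\<^sup>2 / 2) / (1 + l\<^sup>2)\<close>
  over all cells is positive with expectation 1. The test rejects when a mixture of such products
  (over scales \<open>4 ^ r\<close>, supports \<open>S\<close> and, per coordinate, a geometric grid of tilts) is at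
  least \<open>2 / \<epsilon>\<close>; Markov's inequality controls the type I error.

  Under the alternative it suffices to choose one component of the mixture and to bound the
  expectation of its reciprocal. With \<open>t\<close> columns, a shift of \<open>d\<close> in one coordinate yields
  a factor \<open>exp (- t * gain (d\<^sup>2))\<close>, where \<open>gain\<close> is linear near 0 and logarithmic at
  infinity. Write \<open>A\<close> for the detection rate divided by \<open>s\<close>. The support consists of
  \<open>k\<close> coordinates with \<open>t d\<^sup>2\<close> at least a multiple of \<open>A * sqrt (s / k)\<close>, which pays for
  their share of the entropy \<open>k ln (e p / k)\<close> as soon as \<open>t \<ge> 8 A\<close>. Since
  \<open>sqrt (s / k)\<close> sums to at most \<open>2 s\<close>, the discarded coordinates carry only a fraction of
  the signal, and the remaining total pays for the choice of the scale.
\<close>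

subsection \<open>Bets against centred noise\<close>

text \<open>
  The normalisation makes \<open>bet l\<close> integrate to 1 under every centred law with second
  moment 2, the second moment of a difference of two noise entries.
\<close>

definition bet :: "real \<Rightarrow> real \<Rightarrow> real" where
  "bet l z = (1 + l * z + (l * z)\<^sup>2 / 2) / (1 + l\<^sup>2)"

lemma quadratic_eq: "1 + x + x\<^sup>2 / 2 = (1 + (1 + x)\<^sup>2) / 2" for x :: real
  by (simp add: power2_eq_square field_simps)

lemma quadratic_pos: "0 < 1 + x + x\<^sup>2 / 2" for x :: real
  unfolding quadratic_eq by (simp add: add_pos_nonneg)

lemma one_plus_square_pos: "0 < 1 + x\<^sup>2" for x :: real
  by (simp add: add_pos_nonneg)

lemma bet_pos: "0 < bet l z"
  unfolding bet_def by (intro divide_pos_pos quadratic_pos one_plus_square_pos)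

lemma inverse_bet: "inverse (bet l z) = (1 + l\<^sup>2) * inverse (1 + l * z + (l * z)\<^sup>2 / 2)"
  by (simp only: bet_def inverse_divide divide_inverse[of "1 + l\<^sup>2"])

lemma bet_0 [simp]: "bet 0 z = 1"
  by (simp add: bet_def)

lemma borel_measurable_bet [measurable]: "bet l \<in> borel_measurable borel"
  unfolding bet_def by measurable

text \<open>The two conjugate quadratics multiply to \<open>1 + x ^ 4 / 4\<close>. The reciprocal
  thus has a majorant of degree two, whose expectation involves second moments only.\<close>

lemma inverse_quadratic_le: "inverse (1 + x + x\<^sup>2 / 2) \<le> 1 - x + x\<^sup>2 / 2" for x :: real
proof -
  have "(1 - x + x\<^sup>2 / 2) * (1 + x + x\<^sup>2 / 2) = 1 + x ^ 4 / 4"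
    by (simp add: power2_eq_square power4_eq_xxxx field_simps)
  moreover have "0 \<le> x ^ 4" by simp
  ultimately have "1 \<le> (1 - x + x\<^sup>2 / 2) * (1 + x + x\<^sup>2 / 2)" by linarith
  thus ?thesis
    using quadratic_pos[of x] by (simp add: inverse_eq_divide pos_divide_le_eq)
qed

text \<open>The difference of the two sides is a sum of squares. It moves a perturbation out of a
  denominator at the cost of a factor \<open>1 + v\<^sup>2\<close>.\<close>

lemma peetre_inequality: "1 + a\<^sup>2 \<le> 2 * (1 + (a + v)\<^sup>2) * (1 + v\<^sup>2)" for a v :: real
proof -
  have "2 * (1 + (a + v)\<^sup>2) * (1 + v\<^sup>2) - (1 + a\<^sup>2) = 1 + (a + 2 * v)\<^sup>2 + 2 * ((a + v) * v)\<^sup>2"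
    by (simp add: power2_eq_square algebra_simps)
  also have "\<dots> \<ge> 0" by simp
  finally show ?thesis by simp
qed

text \<open>Separates signal and noise: with \<open>y = l * d\<close> and \<open>v = l * W x\<close>
  the denominator becomes deterministic, and the noise enters through its square only.\<close>

lemma inverse_quadratic_shift_le:
  "inverse (1 + (y + v) + (y + v)\<^sup>2 / 2) \<le> 4 * (1 + v\<^sup>2) / (1 + (1 + y)\<^sup>2)" for y v :: real
proof -
  have "1 + (1 + y)\<^sup>2 \<le> 2 * (1 + (1 + (y + v))\<^sup>2) * (1 + v\<^sup>2)"
    using peetre_inequality[of "1 + y" v] by (simp add: add.assoc)
  hence "2 * (1 + (1 + y)\<^sup>2) \<le> 4 * (1 + v\<^sup>2) * (1 + (1 + (y + v))\<^sup>2)"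
    by (simp only: mult_ac) (simp add: mult_ac)
  hence "2 / (1 + (1 + (y + v))\<^sup>2) \<le> 4 * (1 + v\<^sup>2) / (1 + (1 + y)\<^sup>2)"
    using one_plus_square_pos[of "1 + y"] one_plus_square_pos[of "1 + (y + v)"]
    by (simp only: divide_le_eq pos_le_divide_eq times_divide_eq_left)
       (simp add: divide_le_eq pos_le_divide_eq times_divide_eq_left)
  thus ?thesis unfolding quadratic_eq by simp
qed

text \<open>
  The first bound is sharp for small \<open>l * d\<close>; the second one decays in \<open>d\<close> for fixed
  \<open>l\<close>, which is the best that a finite variance allows.
\<close>

definition tilt_bound :: "real \<Rightarrow> real \<Rightarrow> real" where
  "tilt_bound l d = min (exp (2 * l\<^sup>2 - l * d + (l * d)\<^sup>2 / 2))
     (4 * (1 + l\<^sup>2) * (1 + 2 * l\<^sup>2) / (1 + (1 + l * d)\<^sup>2))"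

context prob_space
begin

lemma nn_integral_le_integral_bound:
  fixes g h :: "'a \<Rightarrow> real"
  assumes "integrable M h" "\<And>x. 0 \<le> h x" "\<And>x. g x \<le> h x" "expectation h \<le> c"
  shows "(\<integral>\<^sup>+x. ennreal (g x) \<partial>M) \<le> ennreal c"
proof -
  have "(\<integral>\<^sup>+x. ennreal (g x) \<partial>M) \<le> (\<integral>\<^sup>+x. ennreal (h x) \<partial>M)"
    by (intro nn_integral_mono ennreal_leI assms)
  also have "\<dots> = ennreal (expectation h)"
    by (intro nn_integral_eq_integral assms AE_I2)
  also have "\<dots> \<le> ennreal c" by (intro ennreal_leI assms)
  finally show ?thesis .
qed

context
  fixes W :: "'a \<Rightarrow> real"
  assumes int: "integrable M W" and mean: "expectation W = 0"
    and int2: "integrable M (\<lambda>x. (W x)\<^sup>2)" and var: "expectation (\<lambda>x. (W x)\<^sup>2) = 2"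
begin

lemma nn_integral_bet: "(\<integral>\<^sup>+x. ennreal (bet l (W x)) \<partial>M) = 1"
proof -
  have eq: "bet l (W x) = (1 + l * W x + l\<^sup>2 / 2 * (W x)\<^sup>2) / (1 + l\<^sup>2)" for x
    by (simp add: bet_def power_mult_distrib)
  have i: "integrable M (\<lambda>x. bet l (W x))"
    unfolding eq using int int2 by auto
  have "(\<integral>\<^sup>+x. ennreal (bet l (W x)) \<partial>M) = ennreal (expectation (\<lambda>x. bet l (W x)))"
    by (intro nn_integral_eq_integral i AE_I2 less_imp_le bet_pos)
  also have "expectation (\<lambda>x. bet l (W x)) = (1 + l * 0 + l\<^sup>2 / 2 * 2) / (1 + l\<^sup>2)"
    unfolding eq using int int2 by (simp add: mean var prob_space)
  also have "\<dots> = 1" using one_plus_square_pos[of l] by simp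
  finally show ?thesis by simp
qed

lemma nn_integral_inverse_bet_le_exp:
  "(\<integral>\<^sup>+x. ennreal (inverse (bet l (d + W x))) \<partial>M) \<le> ennreal (exp (2 * l\<^sup>2 - l * d + (l * d)\<^sup>2 / 2))"
proof (rule nn_integral_le_integral_bound)
  let ?h = "\<lambda>x. (1 + l\<^sup>2) * (1 - l * (d + W x) + (l * (d + W x))\<^sup>2 / 2)"
  \<comment> \<open>Expanded in powers of \<open>W x\<close>, so that the linear term drops out in
    expectation.\<close>
  have eq: "?h x = (1 + l\<^sup>2) * (1 - l * d + (l * d)\<^sup>2 / 2 + (l\<^sup>2 * d - l) * W x + l\<^sup>2 / 2 * (W x)\<^sup>2)" for x
    by (simp add: power2_eq_square field_simps)
  show "integrable M ?h" unfolding eq using int int2 by auto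
  show "0 \<le> ?h x" for x
    using quadratic_pos[of "- (l * (d + W x))"] by simp
  show "inverse (bet l (d + W x)) \<le> ?h x" for x
    unfolding inverse_bet by (intro mult_left_mono inverse_quadratic_le) simp
  have "expectation ?h = (1 + l\<^sup>2) * (1 - l * d + (l * d)\<^sup>2 / 2 + (l\<^sup>2 * d - l) * 0 + l\<^sup>2 / 2 * 2)"
    unfolding eq using int int2 by (simp add: mean var prob_space)
  also have "\<dots> = (1 + l\<^sup>2) * (1 + (l\<^sup>2 - l * d + (l * d)\<^sup>2 / 2))" by simp
  also have "\<dots> \<le> exp (l\<^sup>2) * exp (l\<^sup>2 - l * d + (l * d)\<^sup>2 / 2)"
  proof (intro mult_mono exp_ge_add_one_self)
    show "0 \<le> 1 + (l\<^sup>2 - l * d + (l * d)\<^sup>2 / 2)"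
      using quadratic_pos[of "- (l * d)"] zero_le_power2[of l]
      unfolding power2_minus by linarith
  qed simp
  also have "\<dots> = exp (2 * l\<^sup>2 - l * d + (l * d)\<^sup>2 / 2)"
    by (simp add: exp_add[symmetric])
  finally show "expectation ?h \<le> exp (2 * l\<^sup>2 - l * d + (l * d)\<^sup>2 / 2)" .
qed

lemma nn_integral_inverse_bet_le_rational:
  "(\<integral>\<^sup>+x. ennreal (inverse (bet l (d + W x))) \<partial>M)
     \<le> ennreal (4 * (1 + l\<^sup>2) * (1 + 2 * l\<^sup>2) / (1 + (1 + l * d)\<^sup>2))"
proof (rule nn_integral_le_integral_bound)
  let ?h = "\<lambda>x. 4 * (1 + l\<^sup>2) * (1 + l\<^sup>2 * (W x)\<^sup>2) / (1 + (1 + l * d)\<^sup>2)"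
  show "integrable M ?h" using int int2 by auto
  show "0 \<le> ?h x" for x by simp
  show "inverse (bet l (d + W x)) \<le> ?h x" for x
  proof -
    have "inverse (bet l (d + W x))
        = (1 + l\<^sup>2) * inverse (1 + (l * d + l * W x) + (l * d + l * W x)\<^sup>2 / 2)"
      by (simp add: inverse_bet distrib_left)
    also have "\<dots> \<le> (1 + l\<^sup>2) * (4 * (1 + (l * W x)\<^sup>2) / (1 + (1 + l * d)\<^sup>2))"
      by (intro mult_left_mono inverse_quadratic_shift_le) simp
    also have "\<dots> = ?h x" by (simp add: power_mult_distrib field_simps)
    finally show ?thesis .
  qed
  show "expectation ?h \<le> 4 * (1 + l\<^sup>2) * (1 + 2 * l\<^sup>2) / (1 + (1 + l * d)\<^sup>2)"
    using int int2 by (simp add: var prob_space mult.commute[of 2])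
qed

lemma nn_integral_inverse_bet_le:
  "(\<integral>\<^sup>+x. ennreal (inverse (bet l (d + W x))) \<partial>M) \<le> ennreal (tilt_bound l d)"
  using nn_integral_inverse_bet_le_exp[of l d] nn_integral_inverse_bet_le_rational[of l d]
  by (simp add: tilt_bound_def min_def)

end

end

subsection \<open>Gain of a well-chosen tilt\<close>

lemma ln_one_plus_scale:
  fixes \<theta> y :: real
  assumes "0 \<le> \<theta>" "\<theta> \<le> 1" "0 \<le> y"
  shows "\<theta> * ln (1 + y) \<le> ln (1 + \<theta> * y)"
proof -
  have "ln ((1 - \<theta>) *\<^sub>R 1 + \<theta> *\<^sub>R (1 + y)) \<ge> (1 - \<theta>) * ln 1 + \<theta> * ln (1 + y)"
    using assms by (intro concave_onD[OF ln_concave]) auto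
  thus ?thesis by (simp add: algebra_simps)
qed

text \<open>\<open>x * ln (1 + D / x)\<close> is the perspective of a concave function vanishing at
  0, hence nondecreasing in \<open>x\<close>. In lower bounds it replaces the number of columns by a
  smaller, more convenient value.\<close>

lemma scaled_ln_mono:
  fixes x t D :: real
  assumes "0 < x" "x \<le> t" "0 \<le> D"
  shows "x * ln (1 + D / x) \<le> t * ln (1 + D / t)"
proof -
  have "x / t * ln (1 + D / x) \<le> ln (1 + x / t * (D / x))"
    using assms by (intro ln_one_plus_scale) auto
  moreover have "x / t * (D / x) = D / t" using assms by simp
  ultimately have "t * (x / t * ln (1 + D / x)) \<le> t * ln (1 + D / t)"
    using assms by (intro mult_left_mono) auto
  thus ?thesis using assms by simp
qed

lemma ln_one_plus_sum_le:
  assumes "finite S" "\<And>i. i \<in> S \<Longrightarrow> (0::real) \<le> a i"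
  shows "ln (1 + (\<Sum>i\<in>S. a i)) \<le> (\<Sum>i\<in>S. ln (1 + a i))"
  using assms
proof (induction S rule: finite_induct)
  case (insert i S)
  have s: "0 \<le> sum a S" "0 \<le> a i" using insert by (auto intro: sum_nonneg)
  have "ln (1 + (a i + sum a S)) \<le> ln ((1 + a i) * (1 + sum a S))"
    using s by (subst ln_le_cancel_iff) (auto simp: algebra_simps add_pos_nonneg)
  also have "\<dots> = ln (1 + a i) + ln (1 + sum a S)"
    using s by (intro ln_mult_pos) auto
  finally show ?case using insert by fastforce
qed simp

text \<open>The first term covers small shifts, at the price of the factor 64. The second has
  coefficient 1 in front of the logarithm, which matters when the number of columns is only a small
  multiple of the entropy per coordinate.\<close>

definition gain :: "real \<Rightarrow> real" where
  "gain y = max (ln (1 + y) / 64) (ln ((1 + y) / 30))"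

text \<open>For \<open>d \<le> 4\<close> the second term of \<open>gain\<close> is nonpositive. The
  bounds on \<open>l\<close> make both quadratic terms at most \<open>l * d / 4\<close>, so the
  exponent is at most \<open>- (l * d / 2)\<close>.\<close>

lemma gain_small:
  assumes "0 < d" "d \<le> 4" "0 < l" "l \<le> d / 8" "l * d \<le> 1 / 2" "ln (1 + d\<^sup>2) \<le> 32 * (l * d)"
  shows "exp (2 * l\<^sup>2 - l * d + (l * d)\<^sup>2 / 2) \<le> exp (- gain (d\<^sup>2))"
proof -
  have "d\<^sup>2 \<le> 4\<^sup>2" using assms by (intro power_mono) auto
  hence "ln ((1 + d\<^sup>2) / 30) \<le> 0" using one_plus_square_pos[of d] by (simp add: ln_le_zero_iff)
  moreover have "0 \<le> ln (1 + d\<^sup>2)" by simp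
  ultimately have "gain (d\<^sup>2) = ln (1 + d\<^sup>2) / 64" unfolding gain_def by linarith
  moreover have "2 * l\<^sup>2 \<le> l * d / 4"
    using mult_left_mono[OF assms(4), of l] assms(3) by (simp add: power2_eq_square)
  moreover have "(l * d)\<^sup>2 \<le> l * d / 2"
    using mult_left_mono[OF assms(5), of "l * d"] assms by (simp add: power2_eq_square)
  ultimately show ?thesis using assms(6) by simp
qed

text \<open>At tilt 1/2 the rational bound has numerator 15/2 and a denominator growing like
  \<open>d\<^sup>2 / 4\<close>; the quotient of these coefficients is the 30 in
  \<open>gain\<close>.\<close>

lemma gain_large:
  assumes "4 \<le> d"
  shows "4 * (1 + (1/2)\<^sup>2) * (1 + 2 * (1/2)\<^sup>2) / (1 + (1 + 1/2 * d)\<^sup>2) \<le> exp (- gain (d\<^sup>2))"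
proof -
  note pos = one_plus_square_pos[of d] one_plus_square_pos[of "1 + 1/2 * d"]
  have d2: "4 * d \<le> d\<^sup>2" using mult_right_mono[OF assms, of d] assms by (simp add: power2_eq_square)
  have "ln (1 + d\<^sup>2) / 64 \<le> ln (1 + d\<^sup>2 / 64)"
    using ln_one_plus_scale[of "1/64" "d\<^sup>2"] by simp
  hence "exp (ln (1 + d\<^sup>2) / 64) \<le> 1 + d\<^sup>2 / 64"
    using add_pos_nonneg[of 1 "d\<^sup>2 / 64"] by (subst (asm) ln_ge_iff) auto
  hence "15/2 * exp (ln (1 + d\<^sup>2) / 64) \<le> 15/2 * (1 + d\<^sup>2 / 64)" by simp
  also have "\<dots> \<le> 1 + (1 + 1/2 * d)\<^sup>2"
  proof -
    have "1 + (1 + 1/2 * d)\<^sup>2 = 2 + d + d\<^sup>2 / 4" by (simp add: power2_eq_square field_simps)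
    moreover have "15/2 * (1 + d\<^sup>2 / 64) = 15/2 + 15/128 * d\<^sup>2" by simp
    ultimately show ?thesis using d2 assms by linarith
  qed
  finally have 1: "15/2 / (1 + (1 + 1/2 * d)\<^sup>2) \<le> exp (- (ln (1 + d\<^sup>2) / 64))"
    using pos by (simp add: exp_minus divide_simps mult.commute)
  have "15/2 * (1 + d\<^sup>2) \<le> 30 * (1 + (1 + 1/2 * d)\<^sup>2)"
    using assms by (simp add: power2_eq_square field_simps)
  hence 2: "15/2 / (1 + (1 + 1/2 * d)\<^sup>2) \<le> exp (- ln ((1 + d\<^sup>2) / 30))"
    using pos by (simp add: exp_minus divide_simps mult.commute)
  have eq: "4 * (1 + (1/2)\<^sup>2) * (1 + 2 * (1/2)\<^sup>2) = (15/2 :: real)"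
    by (simp add: power2_eq_square)
  have "gain (d\<^sup>2) = ln (1 + d\<^sup>2) / 64 \<or> gain (d\<^sup>2) = ln ((1 + d\<^sup>2) / 30)"
    unfolding gain_def by linarith
  thus ?thesis unfolding eq using 1 2 by (elim disjE) (simp_all only:)
qed

text \<open>The argument of the logarithm is the reciprocal of \<open>scale_weight m / 2\<close>,
  the prior mass of a signed tilt with index \<open>m\<close>.\<close>

lemma ln_succ_mult_le: "ln (2 * (real m + 1) * (real m + 2)) \<le> 2 * 2 ^ m"
proof -
  have "2 * (real m + 1) * (real m + 2) \<le> 4 ^ (m + 1)"
  proof (induction m)
    case (Suc m)
    have "2 * (real (Suc m) + 1) * (real (Suc m) + 2) \<le> 4 * (2 * (real m + 1) * (real m + 2))"
      by (simp add: algebra_simps)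
    thus ?case using Suc by simp
  qed simp
  also have "\<dots> = exp (ln 4 * (real m + 1))"
    using exp_of_nat_mult[of "m + 1" "ln (4::real)"] by (simp add: mult.commute add.commute)
  finally have "ln (2 * (real m + 1) * (real m + 2)) \<le> ln (exp (ln 4 * (real m + 1)))"
    by (intro ln_mono) (auto intro: mult_pos_pos)
  hence "ln (2 * (real m + 1) * (real m + 2)) \<le> ln 4 * (real m + 1)" by simp
  also have "ln 4 * (real m + 1) \<le> 2 * (real m + 1)"
  proof (rule mult_right_mono)
    have "ln (4::real) = 2 * ln 2" using ln_realpow[of 2 2] by simp
    thus "ln (4::real) \<le> 2" using ln_le_minus_one[of 2] by simp
  qed simp
  also have "real m + 1 \<le> 2 ^ m" by (induction m) auto
  finally show ?thesis by simp
qed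

text \<open>Up to sign the tilt is a power of 1/2: a fixed fraction of the shift if the shift is
  small, a constant otherwise. The last conclusion controls the price of \<open>m\<close>; it says
  that the tilt is at most 1 and at most the modulus of \<open>d\<close>.\<close>

lemma ex_tilt:
  fixes d :: real
  assumes r: "3 \<le> r" and D: "256 \<le> 4 ^ r * d\<^sup>2"
  obtains m b l where "m \<le> r" "l = (if b then 1 else - 1) * 2 ^ m / 2 ^ r"
    "tilt_bound l d \<le> exp (- gain (d\<^sup>2))"
    "2 ^ m \<le> sqrt (min (4 ^ r) (4 ^ r * d\<^sup>2))"
proof -
  let ?G = "\<lambda>l d. min (exp (2 * l\<^sup>2 - l * d + (l * d)\<^sup>2 / 2))
    (4 * (1 + l\<^sup>2) * (1 + 2 * l\<^sup>2) / (1 + (1 + l * d)\<^sup>2))"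
  define e where "e = \<bar>d\<bar>"
  have e2: "e\<^sup>2 = d\<^sup>2" by (simp add: e_def)
  have "d \<noteq> 0" using D by auto
  hence e0: "0 < e" by (simp add: e_def)
  have pow4: "(4::real) ^ r = (2 ^ r)\<^sup>2" by (simp flip: power_mult_distrib power_mult add: power2_eq_square)
  have s1: "sqrt (4 ^ r) = 2 ^ r" by (simp add: pow4)
  have s2: "sqrt (4 ^ r * d\<^sup>2) = 2 ^ r * e" by (simp add: pow4 real_sqrt_mult e_def)
  have s: "sqrt (min (4 ^ r) (4 ^ r * d\<^sup>2)) = min (2 ^ r) (2 ^ r * e)"
  proof -
    have "sqrt (min x y) = min (sqrt x) (sqrt y)" for x y by (simp add: min_def)
    thus ?thesis by (simp only: s1 s2)
  qed
  \<comment> \<open>For \<open>e \<le> 2\<close> the tilt chosen below is at least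
    \<open>e / 16\<close>, so this keeps it above the smallest grid value
    \<open>1 / 2 ^ r\<close>.\<close>
  have e16: "16 \<le> 2 ^ r * e"
    using real_sqrt_le_mono[OF D] real_sqrt_abs[of 16] unfolding s2 by simp
  note witness = that
  have *: thesis if h: "j \<le> r" "?G (1 / 2 ^ j) e \<le> exp (- gain (e\<^sup>2))" "1 / 2 ^ j \<le> min 1 e" for j
  proof (rule witness[of "r - j" "(if 0 \<le> d then 1 else - 1) * 2 ^ (r - j) / 2 ^ r" "0 \<le> d"])
    have l: "2 ^ (r - j) / 2 ^ r = (1 / 2 ^ j :: real)"
      using h(1) by (simp add: power_diff)
    let ?l = "(if 0 \<le> d then 1 else - 1) * 2 ^ (r - j) / 2 ^ r :: real"
    have "?l * d = 1 / 2 ^ j * e" "?l\<^sup>2 = (1 / 2 ^ j)\<^sup>2"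
      unfolding l[symmetric] by (simp_all add: e_def)
    thus "tilt_bound ?l d \<le> exp (- gain (d\<^sup>2))"
      using h(2) unfolding tilt_bound_def by (simp only: e2)
    have "2 ^ (r - j) = 2 ^ r * (1 / 2 ^ j :: real)" using l by (simp add: field_simps)
    also have "\<dots> \<le> 2 ^ r * min 1 e" using h(3) by (intro mult_left_mono) auto
    finally show "2 ^ (r - j) \<le> sqrt (min (4 ^ r) (4 ^ r * d\<^sup>2))"
      unfolding s by (auto simp: min_def split: if_splits)
  qed auto
  consider "e \<le> 2" | "2 < e" "e < 4" | "4 \<le> e" by linarith
  thus thesis
  proof cases
    case 1
    have "\<exists>j. (1/2) ^ j \<le> e / 8"
      using real_arch_pow_inv[of "e / 8" "1/2"] e0 by (auto intro: less_imp_le)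
    \<comment> \<open>The least exponent gives the largest power of 1/2 not above
      \<open>e / 8\<close>, which is at least \<open>e / 16\<close>.\<close>
    moreover define j where "j = (LEAST j. (1/2) ^ j \<le> e / 8)"
    ultimately have j: "(1/2) ^ j \<le> e / 8" "\<And>k. k < j \<Longrightarrow> \<not> (1/2) ^ k \<le> e / 8"
      unfolding j_def by (auto intro: LeastI_ex dest: not_less_Least)
    have "j \<noteq> 0" using j(1) 1 by (cases j) auto
    then obtain k where k: "j = Suc k" by (cases j) auto
    have lo: "e / 16 \<le> (1/2) ^ j" using j(2)[of k] k by simp
    define l where "l = (1/2::real) ^ j"
    have l: "0 < l" "l \<le> e / 8" "e / 16 \<le> l" "l = 1 / 2 ^ j"
      using j(1) lo by (auto simp: l_def power_divide)
    show thesis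
    proof (rule *)
      have "e\<^sup>2 / 16 \<le> l * e" using mult_right_mono[OF l(3), of e] e0 by (simp add: power2_eq_square)
      moreover have "ln (1 + e\<^sup>2) \<le> e\<^sup>2" by (rule ln_add_one_self_le_self) simp
      ultimately have "ln (1 + e\<^sup>2) \<le> 32 * (l * e)" using zero_le_power2[of e] by linarith
      moreover have "l * e \<le> 1 / 4 * 2"
        using l(1,2) e0 1 by (intro mult_mono) auto
      ultimately have "exp (2 * l\<^sup>2 - l * e + (l * e)\<^sup>2 / 2) \<le> exp (- gain (e\<^sup>2))"
        using e0 1 l(1,2) by (intro gain_small) auto
      thus "?G (1 / 2 ^ j) e \<le> exp (- gain (e\<^sup>2))" unfolding l(4)[symmetric] by linarith
      show "1 / 2 ^ j \<le> min 1 e" using l e0 1 by auto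
      have "2 ^ r * e \<le> 2 ^ r * (16 * l)" using l(3) by (intro mult_left_mono) auto
      hence "1 \<le> 2 ^ r * l" using e16 by linarith
      hence "1 / 2 ^ r \<le> l" by (simp add: field_simps)
      thus "j \<le> r" unfolding l(4) by (simp add: divide_simps)
    qed
  next
    case 2
    show thesis
    proof (rule *)
      have "ln (1 + e\<^sup>2) \<le> e\<^sup>2" by (rule ln_add_one_self_le_self) simp
      also have "\<dots> \<le> 4 * e" using 2 mult_right_mono[of e 4 e] by (simp add: power2_eq_square)
      finally have "exp (2 * (1/8)\<^sup>2 - 1/8 * e + (1/8 * e)\<^sup>2 / 2) \<le> exp (- gain (e\<^sup>2))"
        using 2 by (intro gain_small) auto
      hence "?G (1/8) e \<le> exp (- gain (e\<^sup>2))" by (rule min.coboundedI1)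
      moreover have "1 / 2 ^ 3 = (1 / 8 :: real)" by simp
      ultimately show "?G (1 / 2 ^ 3) e \<le> exp (- gain (e\<^sup>2))" by (simp only:)
    qed (use 2 r in auto)
  next
    case 3
    show thesis
    proof (rule *)
      show "?G (1 / 2 ^ 1) e \<le> exp (- gain (e\<^sup>2))"
        using gain_large[OF 3] unfolding power_one_right by (intro min.coboundedI2)
    qed (use 3 r in auto)
  qed
qed

section \<open>Paying the prior costs out of the gain\<close>

lemma exp_ge_two_power: "2 ^ n \<le> exp (real n)"
proof -
  have "(2::real) ^ n \<le> exp 1 ^ n"
    using exp_ge_add_one_self[of 1] by (intro power_mono) auto
  thus ?thesis by (simp add: exp_of_nat_mult[symmetric])
qed

text \<open>Pays for the tilt indices, whose price is at most twice this square root by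
  \<open>ex_tilt\<close> and \<open>ln_succ_mult_le\<close>. The factor 512 is 8 * 64, so that a
  quarter of the gain suffices.\<close>

lemma scaled_ln_ge_sqrt_min:
  assumes t: "1 \<le> t" and D: "exp 1024 \<le> D"
  shows "512 * sqrt (min t D) \<le> t * ln (1 + D / t)"
proof -
  have "2 ^ 1024 \<le> exp (1024::real)" using exp_ge_two_power[of 1024] by simp
  hence D1: "(2 ^ 512)\<^sup>2 \<le> D" using D by (simp add: power_mult[symmetric])
  hence sD: "2 ^ 512 \<le> sqrt D" by (rule real_le_rsqrt)
  have D0: "0 < D" using D exp_gt_zero[of 1024] by linarith
  have ln2: "1 / 2 \<le> ln (2::real)" using ln_one_plus_scale[of "1" 1] ln_ge_iff[of 2 "1/2"] exp_half_le2 by simp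
  have sq: "512 * sqrt x \<le> x / 2" if "2 ^ 20 \<le> x" for x
  proof -
    have "1024 \<le> sqrt x" using that by (intro real_le_rsqrt) simp
    hence "1024 * sqrt x \<le> sqrt x * sqrt x" using that by (intro mult_right_mono) auto
    thus ?thesis using that by simp
  qed
  have big: "(2::real) ^ 20 \<le> 2 ^ 512" by simp
  show ?thesis
  proof (cases "D \<le> t")
    case True
    have "(2::real) ^ 512 \<le> (2 ^ 512)\<^sup>2" by (rule self_le_power) simp_all
    hence "2 ^ 512 \<le> D" using D1 by linarith
    hence "512 * sqrt D \<le> D / 2" using big by (intro sq) linarith
    also have "\<dots> \<le> D * ln (1 + D / D)" using D0 ln2 by simp
    also have "\<dots> \<le> t * ln (1 + D / t)" using D0 True by (intro scaled_ln_mono) auto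
    finally show ?thesis using True by (simp only: min_absorb2)
  next
    case False
    hence m: "min t D = t" by simp
    show ?thesis
    proof (cases "sqrt D \<le> t")
      case True
      have "512 * sqrt t \<le> t / 2" using sD True big by (intro sq) linarith
      also have "\<dots> \<le> t * ln 2" using ln2 t by simp
      also have "\<dots> \<le> t * ln (1 + D / t)"
      proof (intro mult_left_mono ln_mono)
        show "2 \<le> 1 + D / t" using t False by simp
      qed (use t in auto)
      finally show ?thesis unfolding m .
    next
      \<comment> \<open>Now \<open>t\<close> is below \<open>sqrt D\<close>, hence
        \<open>D / t\<close> is above it, and the logarithm alone supplies the factor 512.\<close>
      case lt: False
      have "sqrt D = D / sqrt D" using D0 by (simp add: real_div_sqrt)
      also have "\<dots> \<le> D / t" using lt t D0 by (intro divide_left_mono) auto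
      finally have "ln (sqrt D) \<le> ln (1 + D / t)" using D0 t by (subst ln_le_cancel_iff) (auto intro: add_pos_nonneg)
      moreover have "ln (sqrt D) = ln D / 2" using D0 by (simp add: ln_sqrt)
      moreover have "1024 \<le> ln D" using D D0 by (subst ln_ge_iff) auto
      ultimately have "512 \<le> ln (1 + D / t)" by simp
      moreover have "sqrt t \<le> t"
        using mult_right_mono[of 1 "sqrt t" "sqrt t"] t by simp
      ultimately have "sqrt t * 512 \<le> t * ln (1 + D / t)" using t by (intro mult_mono) auto
      thus ?thesis unfolding m by simp
    qed
  qed
qed

text \<open>With \<open>q = sqrt (s / k)\<close> the left side is the share of one coordinate in the
  price of a support of size \<open>k\<close>. For \<open>t \<ge> 512 * A\<close>, monotonicity
  reduces to \<open>512 * A\<close> columns and the first term of \<open>gain\<close> suffices in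
  spite of its 64. For smaller \<open>t\<close> the second term is used.\<close>

lemma gain_ge_entropy:
  assumes A: "1 \<le> A" and q: "1 \<le> q" and t: "8 * A \<le> t" and D: "exp 1024 * A * q \<le> D"
  shows "3 * A + 2 * ln q \<le> t * gain (D / t) / 4"
proof -
  have t0: "0 < t" using A t by linarith
  have "0 < exp 1024 * A * q" using A q by simp
  hence D0: "0 < D" using D by linarith
  have lq: "0 \<le> ln q" using q by simp
  have *: "3 * A + 2 * ln q \<le> 2 * A * (2 + ln q)"
    using mult_right_mono[OF A lq] A by (simp add: algebra_simps)
  \<comment> \<open>\<open>2 ^ 14\<close> exceeds both 512 and 30 * 512, the losses in the two cases
    below, and \<open>exp 1024\<close> absorbs it.\<close>
  have l: "2 + ln q \<le> ln (exp 1024 * q / 2 ^ 14)"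
  proof -
    have "ln (2 ^ 14) \<le> (14 :: real)"
      using ln_realpow[of 2 14] ln_le_minus_one[of 2] by simp
    moreover have "ln (exp 1024 * q / 2 ^ 14) = 1024 + ln q - ln (2 ^ 14)"
      using q by (subst ln_div) (auto simp: ln_mult_pos)
    ultimately show ?thesis by linarith
  qed
  show ?thesis
  proof (cases "512 * A \<le> t")
    case True
    have "exp 1024 * q / 2 ^ 14 \<le> exp 1024 * q / 512" using q by (intro divide_left_mono) auto
    also have "\<dots> \<le> D / (512 * A)" using D A by (simp add: field_simps)
    finally have "ln (exp 1024 * q / 2 ^ 14) \<le> ln (1 + D / (512 * A))"
      using A q D0 by (subst ln_le_cancel_iff) (auto intro: add_pos_nonneg)
    hence "512 * A * (2 + ln q) \<le> 512 * A * ln (1 + D / (512 * A))"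
      using l A by (intro mult_left_mono) auto
    also have "\<dots> \<le> t * ln (1 + D / t)" using A True D0 by (intro scaled_ln_mono) auto
    also have "\<dots> \<le> t * (64 * gain (D / t))" using t0 by (intro mult_left_mono) (auto simp: gain_def)
    finally show ?thesis using * by simp
  next
    case False
    have "exp 1024 * q / 2 ^ 14 \<le> exp 1024 * q / (30 * 512)" using q by (intro divide_left_mono) auto
    also have "\<dots> \<le> D / (30 * (512 * A))" using D A by (simp add: field_simps)
    also have "\<dots> \<le> D / (30 * t)" using False t0 D0 A by (intro divide_left_mono) auto
    also have "\<dots> \<le> (1 + D / t) / 30" using t0 by (simp add: field_simps)
    finally have "ln (exp 1024 * q / 2 ^ 14) \<le> ln ((1 + D / t) / 30)"
      using t0 q D0 by (subst ln_le_cancel_iff) (auto intro: add_pos_nonneg)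
    also have "\<dots> \<le> gain (D / t)" by (simp add: gain_def)
    finally have "8 * A * (2 + ln q) \<le> t * gain (D / t)"
      using t A lq t0 l by (intro mult_mono) auto
    thus ?thesis using * by simp
  qed
qed

lemma ex_large_subset:
  fixes D :: "'a \<Rightarrow> real" and b :: "nat \<Rightarrow> real"
  assumes "\<And>k. 0 \<le> b k" "finite F"
  shows "\<exists>S\<subseteq>F. (\<forall>i\<in>S. b (card S) \<le> D i) \<and> sum D F \<le> sum D S + sum b {1..card F}"
  using assms(2)
  \<comment> \<open>Coordinates below the threshold for the current cardinality are discarded one at a time.\<close>
proof (induction "card F" arbitrary: F)
  case 0
  thus ?case by auto
next
  case (Suc k)
  show ?case
  proof (cases "\<forall>i\<in>F. b (card F) \<le> D i")
    case False
    then obtain i where i: "i \<in> F" "D i < b (card F)" by force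
    have c: "k = card (F - {i})" using Suc i by simp
    obtain S where S: "S \<subseteq> F - {i}" "\<forall>i\<in>S. b (card S) \<le> D i"
      "sum D (F - {i}) \<le> sum D S + sum b {1..card (F - {i})}"
      using Suc(1)[OF c] Suc.prems by auto
    have "sum D F = D i + sum D (F - {i})" using i Suc.prems by (intro sum.remove) auto
    moreover have "sum b {1..card F} = sum b {1..card (F - {i})} + b (card F)"
      using Suc(2) by (simp add: c[symmetric] flip: Suc(2))
    ultimately show ?thesis using S i by (intro exI[of _ S]) auto
  qed (use Suc in \<open>auto intro!: exI[of _ F] simp: sum_nonneg assms(1)\<close>)
qed

subsection \<open>The mixture and its expectation under the null\<close>

text \<open>Telescopes, as each summand is a difference of consecutive reciprocals.\<close>

lemma sum_inverse_consecutive_le_1: "(\<Sum>m\<le>r. 1 / ((real m + 1) * (real m + 2))) \<le> 1"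
proof -
  have "(\<Sum>m\<le>r. 1 / ((real m + 1) * (real m + 2))) = 1 - 1 / (real r + 2)"
  proof (induction r)
    case (Suc r)
    have "1 / ((real (Suc r) + 1) * (real (Suc r) + 2)) = 1 / (real r + 2) - 1 / (real r + 3)"
      by (simp add: field_simps)
    thus ?case using Suc by (simp add: add.commute)
  qed simp
  thus ?thesis by simp
qed

lemma sum_inverse_consecutive_subset_le_1:
  assumes "finite R"
  shows "(\<Sum>m\<in>R. 1 / ((real m + 1) * (real m + 2))) \<le> 1"
proof -
  have "(\<Sum>m\<in>R. 1 / ((real m + 1) * (real m + 2))) \<le> (\<Sum>m\<le>Max R. 1 / ((real m + 1) * (real m + 2)))"
    using assms by (intro sum_mono2) auto
  also have "\<dots> \<le> 1" by (rule sum_inverse_consecutive_le_1)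
  finally show ?thesis .
qed

lemma sum_Pow_card:
  fixes g :: "nat \<Rightarrow> real"
  assumes "finite A"
  shows "(\<Sum>S\<in>Pow A. g (card S)) = (\<Sum>k\<le>card A. real (card A choose k) * g k)"
proof -
  have "(\<Sum>S\<in>Pow A. g (card S)) = (\<Sum>k\<le>card A. \<Sum>S | S \<in> Pow A \<and> card S = k. g (card S))"
    using assms by (intro sum.group[symmetric]) (auto intro: card_mono)
  also have "\<dots> = (\<Sum>k\<le>card A. real (card A choose k) * g k)"
  proof (intro sum.cong refl)
    fix k
    have "(\<Sum>S | S \<in> Pow A \<and> card S = k. g (card S)) = real (card {S. S \<subseteq> A \<and> card S = k}) * g k"
      by simp
    thus "(\<Sum>S | S \<in> Pow A \<and> card S = k. g (card S)) = real (card A choose k) * g k"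
      using n_subsets[OF assms, of k] by simp
  qed
  finally show ?thesis .
qed

text \<open>
  A configuration \<open>(r, S, \<sigma>)\<close> bets on the first and last \<open>4 ^ r\<close> columns and on the
  coordinates in \<open>S\<close>; for \<open>\<sigma> i = (m, b)\<close> the tilt of coordinate \<open>i\<close> is
  \<open>2 ^ m / 2 ^ r\<close> with sign \<open>b\<close>. Powers of 4 make \<open>2 ^ r\<close> the square root of the number
  of columns, so that the price of \<open>m\<close> depends on the signal-to-noise ratio only.
\<close>

type_synonym config = "nat \<times> nat set \<times> (nat \<Rightarrow> nat \<times> bool)"

definition scales :: "nat \<Rightarrow> nat set" where
  "scales n = {r. 4 ^ r \<le> n div 2}"

definition tilt_choices :: "nat \<Rightarrow> (nat \<times> bool) set" where
  "tilt_choices r = {..r} \<times> UNIV"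

definition configs :: "nat \<Rightarrow> nat \<Rightarrow> config set" where
  "configs p n = (SIGMA r:scales n. SIGMA S:Pow {1..p}. S \<rightarrow>\<^sub>E tilt_choices r)"

text \<open>Polynomial decay keeps prices logarithmic: a scale \<open>r\<close>, at most of order
  \<open>ln n\<close>, costs a multiple of \<open>ln (ln n)\<close>.\<close>

definition scale_weight :: "nat \<Rightarrow> real" where
  "scale_weight m = 1 / ((real m + 1) * (real m + 2))"

text \<open>A geometric prior on the size, shared equally among the supports of that size.\<close>

definition support_weight :: "nat \<Rightarrow> nat \<Rightarrow> real" where
  "support_weight p k = 1 / (2 ^ (k + 1) * real (p choose k))"

definition weight :: "nat \<Rightarrow> config \<Rightarrow> real" where
  "weight p = (\<lambda>(r, S, \<sigma>). scale_weight r * (support_weight p (card S) *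
     (\<Prod>i\<in>S. scale_weight (fst (\<sigma> i)) / 2)))"

definition tilt :: "config \<Rightarrow> nat \<times> nat \<Rightarrow> real" where
  "tilt = (\<lambda>(r, S, \<sigma>) (i, j). if i \<in> S \<and> j \<le> 4 ^ r
     then (if snd (\<sigma> i) then 1 else - 1) * 2 ^ fst (\<sigma> i) / 2 ^ r else 0)"

definition cells :: "nat \<Rightarrow> nat \<Rightarrow> (nat \<times> nat) set" where
  "cells p n = {1..p} \<times> {1..n div 2}"

text \<open>Pairing columns from the two ends removes the unknown mean. Every change point with at
  least \<open>4 ^ r\<close> columns on both sides separates each of the outer \<open>4 ^ r\<close>
  pairs.\<close>

definition mirror :: "nat \<Rightarrow> nat \<times> nat \<Rightarrow> nat \<times> nat" where
  "mirror n = (\<lambda>(i, j). (i, n + 1 - j))"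

definition mirror_diff :: "nat \<Rightarrow> (nat \<times> nat \<Rightarrow> real) \<Rightarrow> nat \<times> nat \<Rightarrow> real" where
  "mirror_diff n x c = x c - x (mirror n c)"

definition evidence :: "nat \<Rightarrow> nat \<Rightarrow> (nat \<times> nat \<Rightarrow> real) \<Rightarrow> real" where
  "evidence p n x =
     (\<Sum>a\<in>configs p n. weight p a * (\<Prod>c\<in>cells p n. bet (tilt a c) (mirror_diff n x c)))"

section \<open>Total mass of the mixture weights\<close>

lemma finite_scales: "finite (scales n)"
proof (rule finite_subset)
  show "scales n \<subseteq> {..n}"
  proof
    fix r assume "r \<in> scales n"
    moreover have "r < 4 ^ r" by (rule power_gt_expt) simp
    ultimately show "r \<in> {..n}" by (simp add: scales_def)
  qed
qed simp

lemma finite_tilt_choices: "finite (tilt_choices r)"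
  by (simp add: tilt_choices_def)

lemma finite_configs: "finite (configs p n)"
  unfolding configs_def using finite_scales
  by (intro finite_SigmaI finite_PiE finite_tilt_choices) (auto intro: finite_subset[OF _ finite_atLeastAtMost])

lemma finite_cells [simp]: "finite (cells p n)"
  by (simp add: cells_def)

lemma scale_weight_pos: "0 < scale_weight m"
  by (simp add: scale_weight_def)

lemma weight_pos:
  assumes "a \<in> configs p n"
  shows "0 < weight p a"
proof -
  obtain r S \<sigma> where a: "a = (r, S, \<sigma>)" by (cases a)
  have "card S \<le> card {1..p}" using assms a by (intro card_mono) (auto simp: configs_def)
  thus ?thesis
    unfolding a weight_def support_weight_def prod.case
    by (intro mult_pos_pos divide_pos_pos prod_pos scale_weight_pos ballI) auto
qed

lemma sum_tilt_choices_le_1: "(\<Sum>y\<in>tilt_choices r. scale_weight (fst y) / 2) \<le> 1"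
proof -
  have "(\<Sum>y\<in>tilt_choices r. scale_weight (fst y) / 2)
      = (\<Sum>m\<le>r. \<Sum>b\<in>(UNIV :: bool set). scale_weight m / 2)"
    unfolding tilt_choices_def by (subst sum.cartesian_product) (simp add: case_prod_unfold)
  also have "\<dots> = (\<Sum>m\<le>r. scale_weight m)" by (simp add: UNIV_bool)
  also have "\<dots> \<le> 1" unfolding scale_weight_def by (rule sum_inverse_consecutive_le_1)
  finally show ?thesis .
qed

text \<open>The layers are summed from the inside: the tilts by exchanging product and sum, the
  supports by counting subsets of each size, the scales by telescoping. Each layer has mass at most
  1.\<close>

lemma sum_weight_le_1: "(\<Sum>a\<in>configs p n. weight p a) \<le> 1"
proof -
  have fin: "finite (S \<rightarrow>\<^sub>E tilt_choices r)" if "S \<in> Pow {1..p}" for S r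
    using that by (intro finite_PiE finite_tilt_choices) (auto intro: finite_subset)
  have "(\<Sum>a\<in>configs p n. weight p a) = (\<Sum>r\<in>scales n.
      \<Sum>(S, \<sigma>)\<in>(SIGMA S:Pow {1..p}. S \<rightarrow>\<^sub>E tilt_choices r). weight p (r, S, \<sigma>))"
    unfolding configs_def using finite_scales fin
    by (subst sum.Sigma) (auto intro!: finite_SigmaI sum.cong)
  also have "\<dots> = (\<Sum>r\<in>scales n. \<Sum>S\<in>Pow {1..p}. \<Sum>\<sigma>\<in>S \<rightarrow>\<^sub>E tilt_choices r. weight p (r, S, \<sigma>))"
    using fin by (intro sum.cong refl sum.Sigma[symmetric]) auto
  also have "\<dots> = (\<Sum>r\<in>scales n. \<Sum>S\<in>Pow {1..p}.
      \<Sum>\<sigma>\<in>S \<rightarrow>\<^sub>E tilt_choices r. scale_weight r * (support_weight p (card S) *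
        (\<Prod>i\<in>S. scale_weight (fst (\<sigma> i)) / 2)))"
    by (simp add: weight_def)
  also have "\<dots> \<le> (\<Sum>r\<in>scales n. \<Sum>S\<in>Pow {1..p}. scale_weight r * (support_weight p (card S) * 1))"
  proof (intro sum_mono)
    fix r S assume "S \<in> Pow {1..p}"
    hence fin: "finite S" by (auto intro: finite_subset)
    have "(\<Sum>\<sigma>\<in>S \<rightarrow>\<^sub>E tilt_choices r. \<Prod>i\<in>S. scale_weight (fst (\<sigma> i)) / 2)
        = (\<Prod>i\<in>S. \<Sum>y\<in>tilt_choices r. scale_weight (fst y) / 2)"
      using fin by (intro prod_sum_PiE[symmetric] finite_tilt_choices)
    also have "\<dots> \<le> 1"
      by (intro prod_le_1 conjI sum_nonneg sum_tilt_choices_le_1) (simp add: less_imp_le[OF scale_weight_pos])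
    finally have "(\<Sum>\<sigma>\<in>S \<rightarrow>\<^sub>E tilt_choices r. \<Prod>i\<in>S. scale_weight (fst (\<sigma> i)) / 2) \<le> 1" .
    thus "(\<Sum>\<sigma>\<in>S \<rightarrow>\<^sub>E tilt_choices r. scale_weight r * (support_weight p (card S) *
        (\<Prod>i\<in>S. scale_weight (fst (\<sigma> i)) / 2))) \<le> scale_weight r * (support_weight p (card S) * 1)"
      unfolding sum_distrib_left[symmetric]
      by (intro mult_left_mono) (auto simp: less_imp_le[OF scale_weight_pos] support_weight_def)
  qed
  also have "\<dots> = (\<Sum>r\<in>scales n. scale_weight r * (\<Sum>S\<in>Pow {1..p}. support_weight p (card S)))"
    by (simp add: sum_distrib_left)
  also have "\<dots> \<le> (\<Sum>r\<in>scales n. scale_weight r * 1)"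
  proof (intro sum_mono mult_left_mono)
    have "(\<Sum>S\<in>Pow {1..p}. support_weight p (card S)) = (\<Sum>k\<le>p. real (p choose k) * support_weight p k)"
      using sum_Pow_card[of "{1..p}" "support_weight p"] by simp
    also have "\<dots> = (\<Sum>k\<le>p. (1/2) ^ Suc k)"
      by (intro sum.cong) (auto simp: support_weight_def power_divide)
    also have "\<dots> = 1 - (1/2) ^ Suc p" by (induction p) simp_all
    also have "\<dots> \<le> 1" by simp
    finally show "(\<Sum>S\<in>Pow {1..p}. support_weight p (card S)) \<le> 1" .
  qed (simp add: less_imp_le[OF scale_weight_pos])
  also have "\<dots> \<le> 1"
    using sum_inverse_consecutive_subset_le_1[OF finite_scales] by (simp add: scale_weight_def)
  finally show ?thesis .
qed

lemma cells_subset_entries: "cells p n \<subseteq> entries p n"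
  by (auto simp: cells_def entries_def)

text \<open>From \<open>j \<le> n div 2\<close> follows \<open>n + 1 - j > n div 2\<close>. Together
  with \<open>mirror_inj\<close> this makes the pairs of a cell and its mirror image
  disjoint.\<close>

lemma mirror_cells: "c \<in> cells p n \<Longrightarrow> mirror n c \<in> entries p n - cells p n"
  by (auto simp: cells_def entries_def mirror_def)

lemma mirror_inj: "inj_on (mirror n) (cells p n)"
  by (auto simp: inj_on_def cells_def mirror_def)

lemma borel_measurable_evidence [measurable]: "evidence p n \<in> borel_measurable (mat_space p n)"
  unfolding evidence_def mirror_diff_def mat_space_def
  using mirror_cells[of _ p n] cells_subset_entries[of p n]
  by (intro borel_measurable_sum borel_measurable_times borel_measurable_prod borel_measurable_const
      measurable_compose[OF _ borel_measurable_bet] borel_measurable_diff measurable_component_singleton) auto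

lemma mirror_diff_mat_add:
  "c \<in> cells p n \<Longrightarrow> mirror_diff n (mat_add p n x y) c = mirror_diff n x c + mirror_diff n y c"
  using mirror_cells[of c p n] cells_subset_entries[of p n]
  by (auto simp: mirror_diff_def mat_add_def)

lemma measurable_mat_add: "mat_add p n x \<in> mat_space p n \<rightarrow>\<^sub>M mat_space p n"
  unfolding mat_add_def mat_space_def by measurable

section \<open>Mirrored noise and expectations of products of bets\<close>

locale noise = prob_space P for P :: "(nat \<times> nat \<Rightarrow> real) measure" +
  fixes p n :: nat and \<alpha> K :: real
  assumes noise: "P \<in> indep_noise_class \<alpha> K p n"
begin

lemma sets_P: "sets P = sets (mat_space p n)"
  and indep_entries: "indep_vars (\<lambda>k. borel) (\<lambda>k e. e k) (entries p n)"
  and marginal: "k \<in> entries p n \<Longrightarrow> distr P borel (\<lambda>e. e k) \<in> noise_class \<alpha> K"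
  using noise by (auto simp: indep_noise_class_def)

lemma measurable_entry: "k \<in> entries p n \<Longrightarrow> (\<lambda>e. e k) \<in> borel_measurable P"
  using indep_entries by (auto simp: indep_vars_def)

lemma entry_moments:
  assumes "k \<in> entries p n"
  shows "integrable P (\<lambda>e. e k)" "expectation (\<lambda>e. e k) = 0"
    "integrable P (\<lambda>e. (e k)\<^sup>2)" "expectation (\<lambda>e. (e k)\<^sup>2) = 1"
  using marginal[OF assms] measurable_entry[OF assms]
  by (auto simp: noise_class_def integrable_distr_eq integral_distr)

lemma entry_product:
  assumes "k \<in> entries p n" "k' \<in> entries p n" "k \<noteq> k'"
  shows "integrable P (\<lambda>e. e k * e k')" "expectation (\<lambda>e. e k * e k') = 0"
proof -
  have ind: "indep_vars (\<lambda>_. borel) (\<lambda>k e. e k :: real) {k, k'}"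
    using assms by (intro indep_vars_subset[OF indep_entries]) auto
  have int: "\<And>i. i \<in> {k, k'} \<Longrightarrow> integrable P (\<lambda>e. e i)"
    using assms entry_moments(1) by auto
  show "integrable P (\<lambda>e. e k * e k')"
    using indep_vars_integrable[OF _ ind int] assms(3) by simp
  show "expectation (\<lambda>e. e k * e k') = 0"
    using indep_vars_lebesgue_integral[OF _ ind int] assms entry_moments(2) by simp
qed

text \<open>Functions of disjoint blocks of independent entries are independent; the blocks are the
  mirrored pairs.\<close>

lemma indep_mirror_diff: "indep_vars (\<lambda>_. borel) (\<lambda>c e. mirror_diff n e c) (cells p n)"
proof -
  have "indep_vars (\<lambda>c. PiM {c, mirror n c} (\<lambda>_. borel))
      (\<lambda>c e. restrict (\<lambda>k. e k :: real) {c, mirror n c}) (cells p n)"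
  proof (rule indep_vars_restrict[OF indep_entries])
    show "{c, mirror n c} \<subseteq> entries p n" if "c \<in> cells p n" for c
      using that mirror_cells[of c p n] cells_subset_entries[of p n] by auto
    show "disjoint_family_on (\<lambda>c. {c, mirror n c}) (cells p n)"
      using mirror_cells[of _ p n] inj_onD[OF mirror_inj[of n p]]
      by (fastforce simp: disjoint_family_on_def)
  qed
  hence "indep_vars (\<lambda>_. borel)
      (\<lambda>c e. (\<lambda>v. v c - v (mirror n c)) (restrict (\<lambda>k. e k :: real) {c, mirror n c})) (cells p n)"
    by (rule indep_vars_compose2)
      (intro borel_measurable_diff measurable_component_singleton, auto)
  thus ?thesis by (simp add: mirror_diff_def)
qed

lemma mirror_diff_moments:
  assumes "c \<in> cells p n"
  shows "integrable P (\<lambda>e. mirror_diff n e c)" "expectation (\<lambda>e. mirror_diff n e c) = 0"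
    "integrable P (\<lambda>e. (mirror_diff n e c)\<^sup>2)" "expectation (\<lambda>e. (mirror_diff n e c)\<^sup>2) = 2"
proof -
  have k: "c \<in> entries p n" "mirror n c \<in> entries p n" "c \<noteq> mirror n c"
    using assms mirror_cells[of c p n] cells_subset_entries[of p n] by auto
  note m = entry_moments[OF k(1)] entry_moments[OF k(2)] entry_product[OF k]
  have eq: "(\<lambda>e. (mirror_diff n e c)\<^sup>2) = (\<lambda>e. (e c)\<^sup>2 + (e (mirror n c))\<^sup>2 - 2 * (e c * e (mirror n c)))"
    by (simp add: mirror_diff_def power2_diff mult.assoc)
  show "integrable P (\<lambda>e. mirror_diff n e c)" "expectation (\<lambda>e. mirror_diff n e c) = 0"
    unfolding mirror_diff_def using m by auto
  show "integrable P (\<lambda>e. (mirror_diff n e c)\<^sup>2)" "expectation (\<lambda>e. (mirror_diff n e c)\<^sup>2) = 2"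
    unfolding eq using m by auto
qed

lemma nn_integral_prod_mirror_diff:
  assumes "\<And>c. c \<in> cells p n \<Longrightarrow> h c \<in> borel_measurable borel" "\<And>c z. 0 \<le> h c z"
  shows "(\<integral>\<^sup>+e. ennreal (\<Prod>c\<in>cells p n. h c (mirror_diff n e c)) \<partial>P)
    = (\<Prod>c\<in>cells p n. \<integral>\<^sup>+e. ennreal (h c (mirror_diff n e c)) \<partial>P)"
proof -
  have "indep_vars (\<lambda>_. borel) (\<lambda>c e. ennreal (h c (mirror_diff n e c))) (cells p n)"
    by (rule indep_vars_compose2[OF indep_mirror_diff]) (use assms(1) in measurable)
  hence "(\<integral>\<^sup>+e. (\<Prod>c\<in>cells p n. ennreal (h c (mirror_diff n e c))) \<partial>P)
    = (\<Prod>c\<in>cells p n. \<integral>\<^sup>+e. ennreal (h c (mirror_diff n e c)) \<partial>P)"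
    by (intro indep_vars_nn_integral) auto
  thus ?thesis by (simp add: prod_ennreal assms(2))
qed

lemma measurable_mirror_diff: "c \<in> cells p n \<Longrightarrow> (\<lambda>e. mirror_diff n e c) \<in> borel_measurable P"
  using indep_mirror_diff by (auto simp: indep_vars_def)

lemma nn_integral_evidence_null:
  assumes "\<theta> \<in> Theta_null p n"
  shows "(\<integral>\<^sup>+e. ennreal (evidence p n (mat_add p n \<theta> e)) \<partial>P) \<le> 1"
proof -
  obtain \<mu> where \<mu>: "\<And>t. t \<in> {1..n} \<Longrightarrow> column p \<theta> t = \<mu>"
    using assms by (auto simp: Theta_null_def)
  have const: "\<theta> (i, t) = \<mu> i" if "(i, t) \<in> entries p n" for i t
    using fun_cong[OF \<mu>[of t], of i] that by (simp add: column_def entries_def)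
  \<comment> \<open>Under the null both columns of a pair have the same mean, so only noise
    remains.\<close>
  have zero: "mirror_diff n \<theta> c = 0" if c: "c \<in> cells p n" for c
    using const[of "fst c" "snd c"] const[of "fst c" "n + 1 - snd c"] mirror_cells[OF c]
      cells_subset_entries[of p n] c
    by (auto simp: mirror_diff_def mirror_def case_prod_unfold)
  have meas: "(\<lambda>e. ennreal (\<Prod>c\<in>cells p n. bet (tilt a c) (mirror_diff n e c))) \<in> borel_measurable P" for a
    by (intro measurable_compose[OF _ measurable_ennreal] borel_measurable_prod
        measurable_compose[OF measurable_mirror_diff borel_measurable_bet])
  have "(\<integral>\<^sup>+e. ennreal (evidence p n (mat_add p n \<theta> e)) \<partial>P)
      = (\<integral>\<^sup>+e. (\<Sum>a\<in>configs p n. ennreal (weight p a) *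
          ennreal (\<Prod>c\<in>cells p n. bet (tilt a c) (mirror_diff n e c))) \<partial>P)"
    unfolding evidence_def
    by (intro nn_integral_cong)
      (simp add: mirror_diff_mat_add zero sum_ennreal[symmetric] ennreal_mult' weight_pos less_imp_le
        prod_nonneg less_imp_le[OF bet_pos])
  also have "\<dots> = (\<Sum>a\<in>configs p n. ennreal (weight p a) *
      (\<integral>\<^sup>+e. ennreal (\<Prod>c\<in>cells p n. bet (tilt a c) (mirror_diff n e c)) \<partial>P))"
    using meas by (subst nn_integral_sum) (auto intro!: sum.cong nn_integral_cmult)
  also have "\<dots> = (\<Sum>a\<in>configs p n. ennreal (weight p a))"
    by (subst nn_integral_prod_mirror_diff[of "\<lambda>c. bet (tilt _ c)"])
      (auto simp: less_imp_le[OF bet_pos] nn_integral_bet mirror_diff_moments)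
  also have "\<dots> = ennreal (\<Sum>a\<in>configs p n. weight p a)"
    by (intro sum_ennreal less_imp_le weight_pos)
  also have "\<dots> \<le> 1" using sum_weight_le_1[of p n] by simp
  finally show ?thesis .
qed

lemma evidence_ge:
  assumes "a \<in> configs p n"
  shows "weight p a * (\<Prod>c\<in>cells p n. bet (tilt a c) (mirror_diff n x c)) \<le> evidence p n x"
  unfolding evidence_def using assms
  by (intro member_le_sum finite_configs)
    (auto intro!: mult_nonneg_nonneg prod_nonneg simp: less_imp_le weight_pos bet_pos)

text \<open>Markov's inequality for a reciprocal: low evidence forces the single component
  \<open>a\<close> to be small, so the indicator is at most a multiple of the inverse product, and
  this factorises by independence.\<close>

lemma nn_integral_low_evidence:
  assumes a: "a \<in> configs p n" and \<epsilon>: "0 < \<epsilon>"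
    and g: "\<And>c. c \<in> cells p n \<Longrightarrow>
      (\<integral>\<^sup>+e. ennreal (inverse (bet (tilt a c) (mirror_diff n \<theta> c + mirror_diff n e c))) \<partial>P) \<le> ennreal (g c)"
    and g0: "\<And>c. 0 \<le> g c"
  shows "(\<integral>\<^sup>+e. ennreal (if 2 / \<epsilon> \<le> evidence p n (mat_add p n \<theta> e) then 0 else 1) \<partial>P)
    \<le> ennreal (2 / (\<epsilon> * weight p a) * (\<Prod>c\<in>cells p n. g c))"
proof -
  let ?b = "\<lambda>c z. bet (tilt a c) (mirror_diff n \<theta> c + z)"
  let ?c = "2 / (\<epsilon> * weight p a)"
  have w: "0 < weight p a" by (rule weight_pos[OF a])
  have le: "(if 2 / \<epsilon> \<le> evidence p n (mat_add p n \<theta> e) then 0 else 1)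
      \<le> ?c * (\<Prod>c\<in>cells p n. inverse (?b c (mirror_diff n e c)))" for e
  proof (cases "2 / \<epsilon> \<le> evidence p n (mat_add p n \<theta> e)")
    case True
    moreover have "0 \<le> ?c * (\<Prod>c\<in>cells p n. inverse (?b c (mirror_diff n e c)))"
      using w \<epsilon> by (intro mult_nonneg_nonneg prod_nonneg ballI) (auto simp: less_imp_le[OF bet_pos])
    ultimately show ?thesis by simp
  next
    case False
    define B where "B = (\<Prod>c\<in>cells p n. ?b c (mirror_diff n e c))"
    have B: "0 < B" unfolding B_def by (intro prod_pos ballI bet_pos)
    have "weight p a * B \<le> evidence p n (mat_add p n \<theta> e)"
      using evidence_ge[OF a, of "mat_add p n \<theta> e"] by (simp add: B_def mirror_diff_mat_add)
    hence "weight p a * B \<le> 2 / \<epsilon>" using False by linarith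
    hence "1 \<le> ?c * inverse B" using B w \<epsilon> by (simp add: field_simps)
    thus ?thesis using False by (simp add: B_def prod_inversef[symmetric] comp_def)
  qed
  have meas: "(\<lambda>z. inverse (?b c z)) \<in> borel_measurable borel" for c by measurable
  have "(\<integral>\<^sup>+e. ennreal (if 2 / \<epsilon> \<le> evidence p n (mat_add p n \<theta> e) then 0 else 1) \<partial>P)
      \<le> (\<integral>\<^sup>+e. ennreal ?c * ennreal (\<Prod>c\<in>cells p n. inverse (?b c (mirror_diff n e c))) \<partial>P)"
    using le w \<epsilon>
    by (intro nn_integral_mono)
      (simp add: ennreal_mult[symmetric] prod_nonneg less_imp_le[OF bet_pos] del: ennreal_mult)
  also have "\<dots> = ennreal ?c * (\<integral>\<^sup>+e. ennreal (\<Prod>c\<in>cells p n. inverse (?b c (mirror_diff n e c))) \<partial>P)"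
    using measurable_mirror_diff by (intro nn_integral_cmult) auto
  also have "\<dots> = ennreal ?c * (\<Prod>c\<in>cells p n. \<integral>\<^sup>+e. ennreal (inverse (?b c (mirror_diff n e c))) \<partial>P)"
    by (subst nn_integral_prod_mirror_diff) (auto simp: meas less_imp_le[OF bet_pos])
  also have "\<dots> \<le> ennreal ?c * (\<Prod>c\<in>cells p n. ennreal (g c))"
    by (intro mult_left_mono prod_mono_ennreal) (auto simp: g)
  also have "\<dots> = ennreal (?c * (\<Prod>c\<in>cells p n. g c))"
    using w \<epsilon> g0 by (subst ennreal_mult) (auto simp: prod_ennreal prod_nonneg)
  finally show ?thesis .
qed

end

subsection \<open>A component that detects a strong signal\<close>

text \<open>Bounds the total signal lost when \<open>ex_large_subset\<close> is applied with
  thresholds proportional to \<open>sqrt (s / k)\<close>.\<close>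

lemma sum_sqrt_quotient_le: "(\<Sum>k=1..s. sqrt (real s / real k)) \<le> 2 * real s"
proof -
  have "(\<Sum>k=1..s. 1 / sqrt (real k)) \<le> 2 * sqrt (real s)"
  proof (induction s)
    case (Suc s)
    define u v where "u = sqrt (real (Suc s))" and "v = sqrt (real s)"
    have u: "0 < u" and uv: "u\<^sup>2 = v\<^sup>2 + 1" by (simp_all add: u_def v_def)
    have "0 \<le> (u - v)\<^sup>2" by simp
    also have "(u - v)\<^sup>2 = 2 * (u - v) * u - (u\<^sup>2 - v\<^sup>2)" by (simp add: power2_eq_square algebra_simps)
    finally have "1 / u \<le> 2 * (u - v)" using u uv by (simp add: pos_divide_le_eq)
    hence "1 / sqrt (real (Suc s)) \<le> 2 * (sqrt (real (Suc s)) - sqrt (real s))"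
      by (simp only: u_def v_def)
    thus ?case using Suc by simp
  qed simp
  hence "sqrt (real s) * (\<Sum>k=1..s. 1 / sqrt (real k)) \<le> sqrt (real s) * (2 * sqrt (real s))"
    by (intro mult_left_mono) auto
  moreover have "sqrt (real s) * (\<Sum>k=1..s. 1 / sqrt (real k)) = (\<Sum>k=1..s. sqrt (real s / real k))"
    unfolding sum_distrib_left by (intro sum.cong refl) (simp add: real_sqrt_divide)
  moreover have "sqrt (real s) * (2 * sqrt (real s)) = 2 * real s" by simp
  ultimately show ?thesis by linarith
qed

text \<open>The classical bound \<open>(e p / k) ^ k\<close>: a single term of the expansion of
  \<open>(1 + k / p) ^ p\<close> is at most \<open>exp k\<close>.\<close>

lemma binomial_le_exp:
  assumes "1 \<le> k" "1 \<le> p"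
  shows "real (p choose k) \<le> exp (real k + real k * ln (real p / real k))"
proof -
  let ?x = "real k / real p"
  have x: "0 < ?x" using assms by simp
  have "real (p choose k) * ?x ^ k \<le> (1 + ?x) ^ p"
  proof (cases "k \<le> p")
    case True
    have "real (p choose k) * ?x ^ k \<le> (\<Sum>j\<le>p. real (p choose j) * ?x ^ j)"
      using True x by (intro member_le_sum) auto
    also have "\<dots> = (1 + ?x) ^ p" using binomial_ring[of ?x 1 p] by (simp add: add.commute)
    finally show ?thesis .
  next
    case False
    thus ?thesis using x by (simp add: binomial_eq_0)
  qed
  also have "\<dots> \<le> exp ?x ^ p" using x by (intro power_mono exp_ge_add_one_self) auto
  also have "exp ?x ^ p = exp (real p * ?x)" by (rule exp_of_nat_mult[symmetric])
  also have "real p * ?x = real k" using assms by simp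
  finally have "real (p choose k) \<le> exp (real k) / ?x ^ k" using x by (simp add: pos_le_divide_eq)
  also have "\<dots> = exp (real k) * (real p / real k) ^ k" by (simp add: power_divide)
  also have "(real p / real k) ^ k = exp (ln (real p / real k)) ^ k"
    using assms by simp
  also have "\<dots> = exp (real k * ln (real p / real k))"
    by (rule exp_of_nat_mult[symmetric])
  finally show ?thesis by (simp only: exp_add)
qed

text \<open>Splitting \<open>ln (p / k)\<close> at \<open>s\<close> separates the uniform cost
  \<open>A\<close> from the surcharge \<open>ln (s / k)\<close> for supports smaller than
  \<open>s\<close>.\<close>

lemma support_weight_ge:
  assumes "1 \<le> k" "k \<le> s" "s \<le> p" and A: "1 + ln (real p / real s) \<le> A"
  shows "exp (- (real k * (3 * A + ln (real s / real k)))) \<le> support_weight p k"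
proof -
  have "2 ^ (k + 1) \<le> exp (real (k + 1))" by (rule exp_ge_two_power)
  also have "\<dots> \<le> exp (2 * real k)" using assms by simp
  finally have "2 ^ (k + 1) * real (p choose k) \<le> exp (2 * real k) * exp (real k + real k * ln (real p / real k))"
    using assms by (intro mult_mono binomial_le_exp) auto
  also have "\<dots> = exp (real k * (3 + ln (real p / real k)))"
    by (simp add: exp_add[symmetric] algebra_simps)
  also have "\<dots> \<le> exp (real k * (3 * A + ln (real s / real k)))"
  proof -
    have "ln (real p / real k) = ln (real p / real s) + ln (real s / real k)"
      using assms by (simp add: ln_div)
    moreover have "0 \<le> ln (real p / real s)" using assms by simp
    ultimately have "3 + ln (real p / real k) \<le> 3 * A + ln (real s / real k)" using A by linarith
    thus ?thesis using assms by simp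
  qed
  finally have *: "2 ^ (k + 1) * real (p choose k) \<le> exp (real k * (3 * A + ln (real s / real k)))" .
  have "0 < 2 ^ (k + 1) * real (p choose k)" using assms by simp
  with * show ?thesis
    unfolding support_weight_def exp_minus inverse_eq_divide by (intro divide_left_mono) auto
qed

text \<open>The budget is the exponent collected by the coordinates of \<open>S\<close> over
  \<open>4 ^ r\<close> columns. One quarter pays for the support, one quarter for the tilts; the
  remaining half pays for the scale and leaves the margin \<open>E\<close>.\<close>

lemma ex_config:
  fixes \<delta> :: "nat \<Rightarrow> real" and A L E C :: real
  assumes s: "1 \<le> s" "s \<le> p" and n: "4 ^ r \<le> n div 2" and r: "3 \<le> r"
    and A: "1 + ln (real p / real s) \<le> A" "8 * A \<le> 4 ^ r" and L: "L = real s * A"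
    and scale: "ln ((real r + 1) * (real r + 2)) \<le> 2 * L" and E: "0 \<le> E"
    and C: "exp (128 * (2 + E)) + 2 * exp 1024 \<le> C"
    and sparse: "card {i \<in> {1..p}. \<delta> i \<noteq> 0} \<le> s"
    and signal: "C * L \<le> 4 ^ r * (\<Sum>i\<in>{1..p}. (\<delta> i)\<^sup>2)"
  obtains S \<sigma> where "S \<subseteq> {1..p}" "(r, S, \<sigma>) \<in> configs p n"
    "\<forall>i\<in>S. \<forall>j\<le>4 ^ r. tilt_bound (tilt (r, S, \<sigma>) (i, j)) (\<delta> i) \<le> exp (- gain ((\<delta> i)\<^sup>2))"
    "exp E \<le> weight p (r, S, \<sigma>) * exp (4 ^ r * (\<Sum>i\<in>S. gain ((\<delta> i)\<^sup>2)))"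
proof -
  define t :: real where "t = 4 ^ r"
  define D where "D i = t * (\<delta> i)\<^sup>2" for i
  define F where "F = {i \<in> {1..p}. \<delta> i \<noteq> 0}"
  define b where "b k = exp 1024 * A * sqrt (real s / real k)" for k
  have "0 \<le> ln (real p / real s)" using s by simp
  hence A1: "1 \<le> A" using A(1) by linarith
  have L1: "1 \<le> L" unfolding L using A1 s mult_mono[of 1 "real s" 1 A] by simp
  have t1: "1 \<le> t" by (simp add: t_def)
  have D0: "0 \<le> D i" for i using t1 by (simp add: D_def)
  have Dt: "D i / t = (\<delta> i)\<^sup>2" for i using t1 by (simp add: D_def)
  have finF: "finite F" by (simp add: F_def)
  \<comment> \<open>Every coordinate that survives can pay its own share. The discarded ones carry
    at most \<open>2 * exp 1024 * L\<close>, which the second summand in the bound on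
    \<open>C\<close> covers.\<close>
  have "\<exists>S\<subseteq>F. (\<forall>i\<in>S. b (card S) \<le> D i) \<and> sum D F \<le> sum D S + sum b {1..card F}"
    using A1 by (intro ex_large_subset finF) (auto simp: b_def)
  then obtain S where S: "S \<subseteq> F" "\<And>i. i \<in> S \<Longrightarrow> b (card S) \<le> D i"
    "sum D F \<le> sum D S + sum b {1..card F}" by blast
  have finS: "finite S" using S(1) finF by (rule finite_subset)
  have Sp: "S \<subseteq> {1..p}" using S(1) by (auto simp: F_def)
  define k where "k = card S"
  have ks: "k \<le> s" using card_mono[OF finF S(1)] sparse by (simp add: k_def F_def)
  have "sum b {1..card F} \<le> sum b {1..s}"
    using sparse A1 by (intro sum_mono2) (auto simp: b_def F_def)
  also have "\<dots> = exp 1024 * A * (\<Sum>k=1..s. sqrt (real s / real k))"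
    by (simp add: b_def sum_distrib_left)
  also have "\<dots> \<le> exp 1024 * A * (2 * real s)"
    using A1 by (intro mult_left_mono sum_sqrt_quotient_le) auto
  finally have b: "sum b {1..card F} \<le> 2 * exp 1024 * L" by (simp add: L mult_ac)
  have "sum D F = sum D {1..p}"
    by (intro sum.mono_neutral_left) (auto simp: F_def D_def)
  also have "\<dots> \<ge> C * L" using signal by (simp add: D_def t_def sum_distrib_left)
  moreover have "(exp (128 * (2 + E)) + 2 * exp 1024) * L \<le> C * L"
    using C L1 by (intro mult_right_mono) auto
  ultimately have DS: "exp (128 * (2 + E)) * L \<le> sum D S"
    using S(3) b by (simp add: algebra_simps)
  have k1: "1 \<le> k"
  proof (rule ccontr)
    assume "\<not> 1 \<le> k"
    hence "S = {}" using finS by (simp add: k_def not_less_eq_eq)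
    moreover have "0 < exp (128 * (2 + E)) * L" using L1 by (intro mult_pos_pos) auto
    ultimately show False using DS by simp
  qed
  define q where "q = sqrt (real s / real k)"
  have q1: "1 \<le> q" using ks k1 by (simp add: q_def)
  have lnq: "ln (real s / real k) = 2 * ln q" using ks k1 by (simp add: q_def ln_sqrt)
  have Dq: "exp 1024 * A * q \<le> D i" if "i \<in> S" for i
    using S(2)[OF that] by (simp add: b_def q_def k_def)
  have De: "exp 1024 \<le> D i" if "i \<in> S" for i
  proof -
    have "1 \<le> A * q" using mult_mono[OF A1 q1] A1 by simp
    hence "exp 1024 * 1 \<le> exp 1024 * (A * q)" by (intro mult_left_mono) auto
    also have "\<dots> \<le> D i" using Dq[OF that] by (simp only: mult.assoc)
    finally show ?thesis by simp
  qed
  have "\<exists>y. fst y \<le> r \<and> tilt_bound ((if snd y then 1 else - 1) * 2 ^ fst y / 2 ^ r) (\<delta> i) \<le> exp (- gain ((\<delta> i)\<^sup>2))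
       \<and> 2 ^ fst y \<le> sqrt (min t (D i))" if i: "i \<in> S" for i
  proof -
    have "256 \<le> (2::real) ^ 1024" by simp
    also have "\<dots> \<le> exp 1024" using exp_ge_two_power[of 1024] by simp
    finally have "256 \<le> 4 ^ r * (\<delta> i)\<^sup>2" using De[OF i] by (simp add: D_def t_def)
    from ex_tilt[OF r this] show ?thesis
      unfolding D_def t_def by (metis fst_conv snd_conv)
  qed
  then obtain f where f: "\<And>i. i \<in> S \<Longrightarrow> fst (f i) \<le> r"
    "\<And>i. i \<in> S \<Longrightarrow> tilt_bound ((if snd (f i) then 1 else - 1) * 2 ^ fst (f i) / 2 ^ r) (\<delta> i)
       \<le> exp (- gain ((\<delta> i)\<^sup>2))"
    "\<And>i. i \<in> S \<Longrightarrow> 2 ^ fst (f i) \<le> sqrt (min t (D i))"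
    by metis
  define \<sigma> where "\<sigma> = restrict f S"
  have conf: "(r, S, \<sigma>) \<in> configs p n"
    using n Sp f(1) by (auto simp: configs_def scales_def \<sigma>_def tilt_choices_def mem_Times_iff)
  define \<Gamma> where "\<Gamma> i = t * gain ((\<delta> i)\<^sup>2)" for i
  have ln_le: "t * ln (1 + D i / t) \<le> 64 * \<Gamma> i" for i
  proof -
    have "t * ln (1 + D i / t) \<le> t * (64 * gain (D i / t))"
      using t1 by (intro mult_left_mono) (auto simp: gain_def)
    thus ?thesis by (simp add: \<Gamma>_def Dt)
  qed
  have cost1: "3 * A + ln (real s / real k) \<le> \<Gamma> i / 4" if "i \<in> S" for i
    using gain_ge_entropy[OF A1 q1 A(2)[folded t_def] Dq[OF that]] by (simp add: lnq Dt \<Gamma>_def)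
  have cost2: "exp (- (\<Gamma> i / 4)) \<le> scale_weight (fst (\<sigma> i)) / 2" if i: "i \<in> S" for i
  proof -
    define m where "m = fst (f i)"
    have "ln (2 * (real m + 1) * (real m + 2)) \<le> 2 * 2 ^ m" by (rule ln_succ_mult_le)
    also have "\<dots> \<le> 2 * sqrt (min t (D i))" using f(3)[OF i] by (simp add: m_def)
    also have "\<dots> \<le> \<Gamma> i / 4" using scaled_ln_ge_sqrt_min[OF t1 De[OF i]] ln_le[of i] by linarith
    finally have "exp (ln (2 * (real m + 1) * (real m + 2))) \<le> exp (\<Gamma> i / 4)"
      by (simp only: exp_le_cancel_iff)
    moreover have "0 < 2 * (real m + 1) * (real m + 2)" by (intro mult_pos_pos) auto
    ultimately have "2 * (real m + 1) * (real m + 2) \<le> exp (\<Gamma> i / 4)"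
      by (simp only: exp_ln)
    hence "1 / exp (\<Gamma> i / 4) \<le> 1 / (2 * (real m + 1) * (real m + 2))"
      by (intro divide_left_mono mult_pos_pos) auto
    also have "\<dots> = scale_weight m / 2" by (simp add: scale_weight_def mult_ac algebra_simps)
    finally show ?thesis using i by (simp add: exp_minus inverse_eq_divide \<sigma>_def m_def)
  qed
  \<comment> \<open>The scale costs at most \<open>2 * L\<close> by assumption and at most
    \<open>2 * t\<close> by \<open>ln_succ_mult_le\<close>. The collected gain is bounded below by a
    multiple of this minimum.\<close>
  define x where "x = min t L"
  have x1: "1 \<le> x" using t1 L1 by (simp add: x_def)
  have cost3: "exp (- (2 * x)) \<le> scale_weight r"
  proof -
    have pos: "0 < (real r + 1) * (real r + 2)" by (intro mult_pos_pos) auto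
    have "ln ((real r + 1) * (real r + 2)) \<le> ln (2 * (real r + 1) * (real r + 2))"
      using pos by (intro ln_mono) auto
    also have "\<dots> \<le> 2 * 2 ^ r" by (rule ln_succ_mult_le)
    also have "\<dots> \<le> 2 * t" unfolding t_def by (intro mult_left_mono power_mono) auto
    finally have "ln ((real r + 1) * (real r + 2)) \<le> 2 * x" using scale by (simp add: x_def)
    hence "exp (ln ((real r + 1) * (real r + 2))) \<le> exp (2 * x)"
      by (simp only: exp_le_cancel_iff)
    hence "(real r + 1) * (real r + 2) \<le> exp (2 * x)" using pos by (simp only: exp_ln)
    thus ?thesis
      unfolding scale_weight_def exp_minus inverse_eq_divide using pos by (intro divide_left_mono) auto
  qed
  have "exp (- (real k * (3 * A + ln (real s / real k)))) \<le> support_weight p k"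
    using k1 ks s A(1) by (rule_tac support_weight_ge) auto
  moreover have "real k * (3 * A + ln (real s / real k)) \<le> (\<Sum>i\<in>S. \<Gamma> i / 4)"
    using sum_bounded_below[of S "3 * A + ln (real s / real k)" "\<lambda>i. \<Gamma> i / 4"] cost1 by (simp add: k_def)
  ultimately have cost4: "exp (- (\<Sum>i\<in>S. \<Gamma> i / 4)) \<le> support_weight p k"
    by (smt (verit) exp_le_cancel_iff)
  have cost5: "exp (- (\<Sum>i\<in>S. \<Gamma> i / 4)) \<le> (\<Prod>i\<in>S. scale_weight (fst (\<sigma> i)) / 2)"
  proof -
    have "exp (- (\<Sum>i\<in>S. \<Gamma> i / 4)) = (\<Prod>i\<in>S. exp (- (\<Gamma> i / 4)))"
      using finS by (simp add: exp_sum sum_negf[symmetric])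
    also have "\<dots> \<le> (\<Prod>i\<in>S. scale_weight (fst (\<sigma> i)) / 2)"
      by (intro prod_mono conjI cost2) auto
    finally show ?thesis .
  qed
  have "exp (- (2 * x)) * (exp (- (\<Sum>i\<in>S. \<Gamma> i / 4)) * exp (- (\<Sum>i\<in>S. \<Gamma> i / 4))) \<le> weight p (r, S, \<sigma>)"
    unfolding weight_def prod.case k_def[symmetric]
    by (intro mult_mono cost3 cost4 cost5) (auto simp: scale_weight_def support_weight_def)
  hence w: "exp (- (2 * x) - sum \<Gamma> S / 2) \<le> weight p (r, S, \<sigma>)"
    by (simp add: exp_add[symmetric] sum_divide_distrib[symmetric])
  \<comment> \<open>As \<open>L / x\<close> is at least 1, the logarithm is at least
    \<open>128 * (2 + E)\<close>. The chain then passes from \<open>x\<close> to \<open>t\<close>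
    and from the total signal to single coordinates. Here 128 is 2 * 64: only half of the gain is
    left, and \<open>gain\<close> carries the factor 1/64.\<close>
  have "x * (128 * (2 + E)) \<le> x * ln (1 + exp (128 * (2 + E)) * L / x)"
  proof (intro mult_left_mono)
    have "exp (128 * (2 + E)) \<le> 1 + exp (128 * (2 + E)) * L / x"
    proof -
      have "x \<le> L" by (simp add: x_def)
      hence "exp (128 * (2 + E)) * 1 \<le> exp (128 * (2 + E)) * (L / x)"
        using x1 by (intro mult_left_mono) auto
      thus ?thesis by simp
    qed
    thus "128 * (2 + E) \<le> ln (1 + exp (128 * (2 + E)) * L / x)"
      using x1 L1 by (subst ln_ge_iff) (auto intro: add_pos_nonneg)
  qed (use x1 in auto)
  also have "\<dots> \<le> t * ln (1 + exp (128 * (2 + E)) * L / t)"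
    using x1 L1 by (intro scaled_ln_mono) (auto simp: x_def)
  also have "\<dots> \<le> t * ln (1 + (\<Sum>i\<in>S. D i / t))"
    unfolding sum_divide_distrib[symmetric] using t1 DS L1
    by (intro mult_left_mono ln_mono add_left_mono divide_right_mono) (auto intro: add_pos_nonneg)
  also have "\<dots> \<le> t * (\<Sum>i\<in>S. ln (1 + D i / t))"
    using t1 D0 finS by (intro mult_left_mono ln_one_plus_sum_le) auto
  also have "\<dots> \<le> 64 * sum \<Gamma> S"
    unfolding sum_distrib_left by (intro sum_mono ln_le)
  finally have "x * (2 + E) \<le> sum \<Gamma> S / 2" by (simp add: algebra_simps)
  moreover have "E \<le> x * E" using mult_right_mono[OF x1 E] by simp
  ultimately have "E \<le> - (2 * x) - sum \<Gamma> S / 2 + sum \<Gamma> S" by (simp add: algebra_simps)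
  hence "exp E \<le> exp (- (2 * x) - sum \<Gamma> S / 2) * exp (sum \<Gamma> S)"
    by (simp add: exp_add[symmetric])
  also have "\<dots> \<le> weight p (r, S, \<sigma>) * exp (sum \<Gamma> S)" using w by (intro mult_right_mono) auto
  finally have "exp E \<le> weight p (r, S, \<sigma>) * exp (4 ^ r * (\<Sum>i\<in>S. gain ((\<delta> i)\<^sup>2)))"
    by (simp add: \<Gamma>_def t_def sum_distrib_left)
  moreover have "tilt_bound (tilt (r, S, \<sigma>) (i, j)) (\<delta> i) \<le> exp (- gain ((\<delta> i)\<^sup>2))"
    if "i \<in> S" "j \<le> 4 ^ r" for i j
    using f(2)[OF that(1)] that by (simp add: tilt_def \<sigma>_def)
  ultimately show thesis using that Sp conf by blast
qed

subsection \<open>The two errors\<close>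

lemma t_res_eq:
  assumes "1 \<le> s" "1 \<le> p"
  shows "t_res p n s = 32 * (2 + ln (real p / real s) + ln (ln (8 * real n)) / real s)"
proof -
  have "ln ((exp 1)\<^sup>2 * real p / real s) = ln ((exp 1)\<^sup>2 * (real p / real s))" by simp
  also have "\<dots> = ln ((exp (1::real))\<^sup>2) + ln (real p / real s)"
    using assms by (intro ln_mult_pos) auto
  also have "ln ((exp (1::real))\<^sup>2) = 2" by (simp add: ln_realpow)
  finally show ?thesis by (simp add: t_res_def divide_inverse)
qed

text \<open>Two blocks of \<open>4 ^ r\<close> columns fit into \<open>n\<close>, so
  \<open>4 ^ (r + 2) \<le> 8 * n\<close> and \<open>r + 2\<close> is at most
  \<open>ln (8 * n)\<close>. The iterated logarithm in the rate thus pays for the scale.\<close>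

lemma ln_ln_ge_scale:
  assumes "4 ^ r \<le> n div 2"
  shows "ln ((real r + 1) * (real r + 2)) \<le> 2 * ln (ln (8 * real n))"
proof -
  have "2 * 4 ^ r \<le> n" using assms by linarith
  hence "real (2 * 4 ^ r) \<le> real n" by (rule of_nat_mono)
  hence le: "4 ^ (r + 2) \<le> 8 * real n" by simp
  have "exp (real (r + 2) * 1) = exp 1 ^ (r + 2)" by (rule exp_of_nat_mult)
  also have "\<dots> \<le> 4 ^ (r + 2)" using exp_le by (intro power_mono) auto
  finally have "real (r + 2) * 1 \<le> ln (4 ^ (r + 2))" by (subst ln_ge_iff) auto
  hence "real r + 2 \<le> ln (4 ^ (r + 2))" by simp
  also have "\<dots> \<le> ln (8 * real n)" using le by (intro ln_mono) auto
  finally have r2: "real r + 2 \<le> ln (8 * real n)" .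
  have "ln ((real r + 1) * (real r + 2)) = ln (real r + 1) + ln (real r + 2)"
    by (intro ln_mult_pos) auto
  also have "\<dots> \<le> ln (ln (8 * real n)) + ln (ln (8 * real n))"
    using r2 by (intro add_mono ln_mono) auto
  finally show ?thesis by simp
qed

text \<open>The two bounds on \<open>j\<close> put columns \<open>j\<close> and
  \<open>n + 1 - j\<close> on opposite sides of the change.\<close>

lemma mirror_diff_change_point:
  assumes "\<forall>t\<in>{1..t0}. column p \<theta> t = \<mu>1" "\<forall>t\<in>{t0<..n}. column p \<theta> t = \<mu>2"
    and "i \<in> {1..p}" "1 \<le> j" "j \<le> t0" "j \<le> n - t0" "t0 \<le> n"
  shows "mirror_diff n \<theta> (i, j) = \<mu>1 i - \<mu>2 i"
proof -
  have "column p \<theta> j = \<mu>1" using assms by auto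
  moreover have "n + 1 - j \<in> {t0<..n}" using assms by auto
  hence "column p \<theta> (n + 1 - j) = \<mu>2" using assms(2) by blast
  ultimately show ?thesis
    using assms(3) by (auto simp: mirror_diff_def mirror_def column_def)
qed

context noise
begin

lemma nn_integral_low_evidence_alternative:
  fixes E C L \<rho> :: real
  assumes s: "1 \<le> s" "s \<le> p" and n: "2 \<le> n" and \<epsilon>: "0 < \<epsilon>" "\<epsilon> < 1"
    and E: "E = ln (4 / \<epsilon>\<^sup>2)"
    and C: "4 * (exp (128 * (2 + E)) + 2 * exp 1024) \<le> C"
    and \<rho>: "C * (real s * ln (exp 1 * real p / real s) + ln (ln (8 * real n))) \<le> \<rho>\<^sup>2"
    and \<theta>: "\<theta> \<in> Theta_res p n s \<rho>"
  shows "(\<integral>\<^sup>+e. ennreal (if 2 / \<epsilon> \<le> evidence p n (mat_add p n \<theta> e) then 0 else 1) \<partial>P)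
    \<le> ennreal (\<epsilon> / 2)"
proof -
  obtain t0 \<mu>1 \<mu>2 where t0: "t0 \<in> {1..n - 1}" "t_res p n s + 1 \<le> real t0" "real t0 \<le> real n - t_res p n s"
    and \<mu>: "\<forall>t\<in>{1..t0}. column p \<theta> t = \<mu>1" "\<forall>t\<in>{t0<..n}. column p \<theta> t = \<mu>2"
    and sparse: "l0_norm p (\<lambda>i. \<mu>1 i - \<mu>2 i) \<le> s"
    and signal: "\<rho>\<^sup>2 \<le> real t0 * (real n - real t0) / real n * (l2_norm p (\<lambda>i. \<mu>1 i - \<mu>2 i))\<^sup>2"
    using \<theta> by (auto simp: Theta_res_def Theta_at_def)
  define \<delta> where "\<delta> i = \<mu>1 i - \<mu>2 i" for i
  define A where "A = 1 + ln (real p / real s) + ln (ln (8 * real n)) / real s"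
  define L where "L = real s * A"
  have "exp 1 \<le> 8 * real n" using n exp_le by linarith
  hence "1 \<le> ln (8 * real n)" using n by (subst ln_ge_iff) auto
  hence ll0: "0 \<le> ln (ln (8 * real n))" by simp
  have lps: "0 \<le> ln (real p / real s)" using s by simp
  have A_ge: "1 + ln (real p / real s) \<le> A" using ll0 by (simp add: A_def)
  have L_eq: "L = real s * ln (exp 1 * real p / real s) + ln (ln (8 * real n))"
  proof -
    have "ln (exp 1 * real p / real s) = ln (exp 1 * (real p / real s))" by simp
    also have "\<dots> = 1 + ln (real p / real s)" using s by (subst ln_mult_pos) auto
    finally show ?thesis using s by (simp add: L_def A_def algebra_simps)
  qed
  have L_ge: "ln (ln (8 * real n)) \<le> L" "0 \<le> L"
    using s lps ll0 by (simp_all add: L_def A_def algebra_simps)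
  \<comment> \<open>The length of the shorter segment. Rounding it down to a power of 4 loses a
    factor below 4, which the factor 4 in the bound on \<open>C\<close> compensates.\<close>
  define m where "m = min t0 (n - t0)"
  have t_res: "t_res p n s = 32 * (1 + A)" using s t_res_eq[of s p n] by (simp add: A_def)
  \<comment> \<open>The restriction on the change point enters here. As 32 is 4 * 8,
    \<open>8 * A \<le> 4 ^ r\<close> survives the rounding; since \<open>A\<close> is at least 1,
    \<open>m\<close> is at least 64 and hence \<open>r \<ge> 3\<close>.\<close>
  have m_ge: "32 * (1 + A) \<le> real m"
  proof -
    have "real (n - t0) = real n - real t0" using t0(1) by (intro of_nat_diff) auto
    thus ?thesis using t0(2,3) unfolding t_res m_def by (simp add: min_def)
  qed
  have "1 \<le> m" using t0 by (auto simp: m_def)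
  then obtain r where r: "4 ^ r \<le> m" "m < 4 ^ (r + 1)"
    using ex_power_ivl1[of 4 m] by auto
  have mr: "real m < 4 * 4 ^ r" using r(2) of_nat_less_iff[of m "4 ^ (r + 1)", where 'a = real] by simp
  have r3: "3 \<le> r"
  proof (rule ccontr)
    assume "\<not> 3 \<le> r"
    hence "(4::real) ^ r \<le> 4 ^ 2" by (intro power_increasing) auto
    thus False using mr m_ge A_ge lps by simp
  qed
  have rn: "4 ^ r \<le> n div 2" using r(1) t0 by (auto simp: m_def min_def split: if_splits)
  have norm: "(l2_norm p (\<lambda>i. \<mu>1 i - \<mu>2 i))\<^sup>2 = (\<Sum>i\<in>{1..p}. (\<delta> i)\<^sup>2)"
    by (simp add: l2_norm_def L2_set_def \<delta>_def sum_nonneg)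
  have "real t0 * (real n - real t0) / real n \<le> real m"
  proof -
    have "real t0 * (real n - real t0) \<le> real m * real n"
    proof (cases "t0 \<le> n - t0")
      case True
      thus ?thesis unfolding m_def using t0 by (intro mult_mono) auto
    next
      case False
      hence "real m = real n - real t0" using t0 by (auto simp: m_def of_nat_diff)
      moreover have "real t0 * (real n - real t0) \<le> real n * (real n - real t0)"
        using t0 by (intro mult_right_mono) auto
      ultimately show ?thesis by (simp add: mult.commute)
    qed
    thus ?thesis using n by (simp add: divide_le_eq)
  qed
  hence "\<rho>\<^sup>2 \<le> real m * (\<Sum>i\<in>{1..p}. (\<delta> i)\<^sup>2)"
    using signal unfolding norm by (smt (verit) mult_right_mono sum_nonneg zero_le_power2)
  also have "\<dots> \<le> 4 * 4 ^ r * (\<Sum>i\<in>{1..p}. (\<delta> i)\<^sup>2)"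
    using mr by (intro mult_right_mono sum_nonneg) auto
  finally have strong: "C / 4 * L \<le> 4 ^ r * (\<Sum>i\<in>{1..p}. (\<delta> i)\<^sup>2)"
    using \<rho> by (simp add: L_eq)
  have E0: "0 \<le> E"
  proof -
    have "\<epsilon>\<^sup>2 \<le> 1" using \<epsilon> by (intro power_le_one) auto
    thus ?thesis unfolding E using \<epsilon> by (intro ln_ge_zero) (simp add: pos_le_divide_eq)
  qed
  have expE: "exp E = 4 / \<epsilon>\<^sup>2" unfolding E using \<epsilon> by simp
  have A_le: "8 * A \<le> 4 ^ r" using mr m_ge by simp
  have scale: "ln ((real r + 1) * (real r + 2)) \<le> 2 * L" using ln_ln_ge_scale[OF rn] L_ge by simp
  have C4: "exp (128 * (2 + E)) + 2 * exp 1024 \<le> C / 4" using C by simp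
  have sparse': "card {i \<in> {1..p}. \<delta> i \<noteq> 0} \<le> s" using sparse by (simp add: l0_norm_def \<delta>_def)
  obtain S \<sigma> where S: "S \<subseteq> {1..p}" and conf: "(r, S, \<sigma>) \<in> configs p n"
    and tilt: "\<forall>i\<in>S. \<forall>j\<le>4 ^ r. tilt_bound (tilt (r, S, \<sigma>) (i, j)) (\<delta> i) \<le> exp (- gain ((\<delta> i)\<^sup>2))"
    and w: "exp E \<le> weight p (r, S, \<sigma>) * exp (4 ^ r * (\<Sum>i\<in>S. gain ((\<delta> i)\<^sup>2)))"
    by (rule ex_config[OF s rn r3 A_ge A_le L_def scale E0 C4 sparse' strong])
  define g where "g = (\<lambda>(i, j :: nat). if i \<in> S \<and> j \<le> 4 ^ r then exp (- gain ((\<delta> i)\<^sup>2)) else (1::real))"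
  define \<Gamma> where "\<Gamma> = 4 ^ r * (\<Sum>i\<in>S. gain ((\<delta> i)\<^sup>2))"
  let ?a = "(r, S, \<sigma>)"
  have "(\<integral>\<^sup>+e. ennreal (if 2 / \<epsilon> \<le> evidence p n (mat_add p n \<theta> e) then 0 else 1) \<partial>P)
      \<le> ennreal (2 / (\<epsilon> * weight p ?a) * (\<Prod>c\<in>cells p n. g c))"
  proof (rule nn_integral_low_evidence[OF conf \<epsilon>(1)])
    fix c assume c: "c \<in> cells p n"
    obtain i j where ij: "c = (i, j)" by (cases c)
    show "(\<integral>\<^sup>+e. ennreal (inverse (bet (tilt ?a c) (mirror_diff n \<theta> c + mirror_diff n e c))) \<partial>P)
        \<le> ennreal (g c)"
    proof (cases "i \<in> S \<and> j \<le> 4 ^ r")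
      case True
      have j: "1 \<le> j" "j \<le> t0" "j \<le> n - t0" "t0 \<le> n"
        using True c r(1) t0(1) by (auto simp: ij cells_def m_def)
      have "i \<in> {1..p}" using True S by blast
      from mirror_diff_change_point[OF \<mu> this j] have d: "mirror_diff n \<theta> c = \<delta> i"
        by (simp add: ij \<delta>_def)
      have "tilt_bound (tilt ?a c) (\<delta> i) \<le> g c"
        using tilt True by (simp add: ij g_def)
      hence "ennreal (tilt_bound (tilt ?a c) (\<delta> i)) \<le> ennreal (g c)" by (rule ennreal_leI)
      thus ?thesis
        unfolding d by (rule order_trans[OF nn_integral_inverse_bet_le[OF mirror_diff_moments[OF c]]])
    next
      case False
      \<comment> \<open>Outside the chosen block the bet is constantly 1, whatever the shift of the
        cell.\<close>
      hence "tilt ?a c = 0" "g c = 1" by (auto simp: ij tilt_def g_def)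
      thus ?thesis by (simp add: emeasure_space_1)
    qed
  qed (auto simp: g_def)
  also have "(\<Prod>c\<in>cells p n. g c) = exp (- \<Gamma>)"
  proof -
    have "(\<Prod>c\<in>cells p n. g c) = (\<Prod>c\<in>S \<times> {1..4 ^ r}. g c)"
      using rn S by (intro prod.mono_neutral_right) (auto simp: cells_def g_def split: if_splits)
    also have "\<dots> = (\<Prod>c\<in>S \<times> {1..4 ^ r :: nat}. exp (- gain ((\<delta> (fst c))\<^sup>2)))"
      by (intro prod.cong) (auto simp: g_def)
    also have "\<dots> = (\<Prod>i\<in>S. \<Prod>j\<in>{1..4 ^ r :: nat}. exp (- gain ((\<delta> i)\<^sup>2)))"
      by (subst prod.cartesian_product) (simp add: case_prod_unfold)
    also have "\<dots> = (\<Prod>i\<in>S. exp (- (4 ^ r * gain ((\<delta> i)\<^sup>2))))"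
    proof (intro prod.cong refl)
      fix i
      have "(\<Prod>j\<in>{1..4 ^ r :: nat}. exp (- gain ((\<delta> i)\<^sup>2))) = exp (- gain ((\<delta> i)\<^sup>2)) ^ (4 ^ r)"
        by simp
      also have "\<dots> = exp (real (4 ^ r) * - gain ((\<delta> i)\<^sup>2))" by (rule exp_of_nat_mult[symmetric])
      finally show "(\<Prod>j\<in>{1..4 ^ r :: nat}. exp (- gain ((\<delta> i)\<^sup>2))) = exp (- (4 ^ r * gain ((\<delta> i)\<^sup>2)))"
        by simp
    qed
    also have "\<dots> = exp (- \<Gamma>)"
      using finite_subset[OF S] by (simp add: \<Gamma>_def sum_distrib_left exp_sum[symmetric] sum_negf)
    finally show ?thesis .
  qed
  \<comment> \<open>\<open>E\<close> was chosen so that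
    \<open>exp E = 4 / \<epsilon>\<^sup>2\<close>, which turns the threshold factor
    \<open>2 / \<epsilon>\<close> into \<open>\<epsilon> / 2\<close>.\<close>
  also have "2 / (\<epsilon> * weight p ?a) * exp (- \<Gamma>) \<le> \<epsilon> / 2"
  proof -
    have wp: "0 < weight p ?a" by (rule weight_pos[OF conf])
    have "4 / \<epsilon>\<^sup>2 \<le> weight p ?a * exp \<Gamma>" using w expE by (simp add: \<Gamma>_def)
    hence "4 \<le> \<epsilon>\<^sup>2 * (weight p ?a * exp \<Gamma>)" using \<epsilon> by (simp add: divide_le_eq mult.commute)
    thus ?thesis using wp \<epsilon> by (simp add: exp_minus divide_simps power2_eq_square mult_ac)
  qed
  finally show ?thesis by (simp add: ennreal_leI)
qed

lemma nn_integral_data_law: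
  assumes "\<theta> \<in> space (mat_space p n)" "f \<in> borel_measurable (mat_space p n)"
  shows "(\<integral>\<^sup>+x. f x \<partial>data_law p n \<theta> P) = (\<integral>\<^sup>+e. f (mat_add p n \<theta> e) \<partial>P)"
proof -
  have "(\<lambda>e. mat_add p n \<theta> e) \<in> P \<rightarrow>\<^sub>M mat_space p n"
    using measurable_mat_add sets_P by (simp cong: measurable_cong_sets)
  thus ?thesis unfolding data_law_def using assms(2) by (simp add: nn_integral_distr)
qed

text \<open>Markov's inequality at the threshold \<open>2 / \<epsilon>\<close>, as the evidence has
  null expectation at most 1.\<close>

lemma nn_integral_high_evidence_null:
  assumes \<theta>: "\<theta> \<in> Theta_null p n" and \<epsilon>: "0 < \<epsilon>"
  shows "(\<integral>\<^sup>+e. ennreal (if 2 / \<epsilon> \<le> evidence p n (mat_add p n \<theta> e) then 1 else 0) \<partial>P) \<le> ennreal (\<epsilon> / 2)"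
proof -
  let ?M = "\<lambda>e. evidence p n (mat_add p n \<theta> e)"
  have M0: "0 \<le> ?M e" for e
    unfolding evidence_def
    by (intro sum_nonneg mult_nonneg_nonneg prod_nonneg) (auto simp: less_imp_le weight_pos bet_pos)
  have le: "(if 2 / \<epsilon> \<le> ?M e then 1 else 0) \<le> \<epsilon> / 2 * ?M e" for e
    using M0[of e] \<epsilon> by (auto simp: field_simps)
  have meas: "?M \<in> borel_measurable P"
    using measurable_mat_add sets_P by (intro measurable_compose[OF _ borel_measurable_evidence]) (simp cong: measurable_cong_sets)
  have "(\<integral>\<^sup>+e. ennreal (if 2 / \<epsilon> \<le> ?M e then 1 else 0) \<partial>P) \<le> (\<integral>\<^sup>+e. ennreal (\<epsilon> / 2) * ennreal (?M e) \<partial>P)"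
    using le \<epsilon> M0 by (intro nn_integral_mono) (simp only: ennreal_mult[symmetric] ennreal_leI less_imp_le half_gt_zero)
  also have "\<dots> = ennreal (\<epsilon> / 2) * (\<integral>\<^sup>+e. ennreal (?M e) \<partial>P)"
    using meas by (intro nn_integral_cmult) auto
  also have "\<dots> \<le> ennreal (\<epsilon> / 2) * 1"
    by (intro mult_left_mono nn_integral_evidence_null[OF \<theta>]) auto
  finally show ?thesis by simp
qed

end

theorem theorem15:
  fixes \<alpha> K \<epsilon> :: real
  assumes "0 < \<alpha>" and "\<alpha> < 2" and "0 < K" and "0 < \<epsilon>" and "\<epsilon> < 1"
  shows "\<exists>C>0. \<forall>n p s :: nat. 2 \<le> n \<longrightarrow> 1 \<le> p \<longrightarrow> s \<in> {1..p} \<longrightarrow>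
           (\<exists>\<phi>. is_test p n \<phi> \<and>
             (\<forall>\<rho>::real. \<rho>\<^sup>2 \<ge> C * (real s * ln (exp 1 * real p / real s) + ln (ln (8 * real n))) \<longrightarrow>
                worst_case_error (indep_noise_class \<alpha> K p n) p n s \<rho> \<phi> \<le> ennreal \<epsilon>))"
proof -
  define E where "E = ln (4 / \<epsilon>\<^sup>2)"
  define C where "C = 4 * (exp (128 * (2 + E)) + 2 * exp 1024)"
  have "0 < C" by (simp add: C_def add_pos_pos)
  moreover have "\<exists>\<phi>. is_test p n \<phi> \<and>
      (\<forall>\<rho>::real. \<rho>\<^sup>2 \<ge> C * (real s * ln (exp 1 * real p / real s) + ln (ln (8 * real n))) \<longrightarrow>
        worst_case_error (indep_noise_class \<alpha> K p n) p n s \<rho> \<phi> \<le> ennreal \<epsilon>)"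
    if n: "2 \<le> n" and p: "1 \<le> p" and s: "s \<in> {1..p}" for n p s :: nat
  proof (intro exI conjI allI impI)
    define \<phi> :: "(nat \<times> nat \<Rightarrow> real) \<Rightarrow> real" where
      "\<phi> = (\<lambda>x. if 2 / \<epsilon> \<le> evidence p n x then 1 else 0)"
    have region: "{x \<in> space (mat_space p n). 2 / \<epsilon> \<le> evidence p n x} \<in> sets (mat_space p n)"
      by (intro borel_measurable_le borel_measurable_const borel_measurable_evidence)
    have \<phi>_borel: "\<phi> \<in> borel_measurable (mat_space p n)"
      unfolding \<phi>_def by (intro measurable_If borel_measurable_const region)
    show "is_test p n \<phi>"
      unfolding is_test_def \<phi>_def by (intro measurable_If measurable_const region) auto
    fix \<rho> :: real
    assume \<rho>: "C * (real s * ln (exp 1 * real p / real s) + ln (ln (8 * real n))) \<le> \<rho>\<^sup>2"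
    have "(\<integral>\<^sup>+x. ennreal (\<phi> x) \<partial>data_law p n \<theta> P) \<le> ennreal (\<epsilon> / 2)"
      if P: "P \<in> indep_noise_class \<alpha> K p n" and \<theta>: "\<theta> \<in> Theta_null p n" for P \<theta>
    proof -
      interpret noise P p n \<alpha> K
        using P by (intro noise.intro noise_axioms.intro) (simp_all add: indep_noise_class_def)
      have "\<theta> \<in> space (mat_space p n)" using \<theta> by (simp add: Theta_null_def)
      moreover have "(\<lambda>x. ennreal (\<phi> x)) \<in> borel_measurable (mat_space p n)"
        by (intro measurable_compose[OF \<phi>_borel measurable_ennreal])
      ultimately have "(\<integral>\<^sup>+x. ennreal (\<phi> x) \<partial>data_law p n \<theta> P)
          = (\<integral>\<^sup>+e. ennreal (\<phi> (mat_add p n \<theta> e)) \<partial>P)"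
        by (rule nn_integral_data_law)
      also have "\<dots> \<le> ennreal (\<epsilon> / 2)"
        unfolding \<phi>_def by (rule nn_integral_high_evidence_null[OF \<theta> \<open>0 < \<epsilon>\<close>])
      finally show ?thesis .
    qed
    moreover have "(\<integral>\<^sup>+x. ennreal (1 - \<phi> x) \<partial>data_law p n \<theta> P) \<le> ennreal (\<epsilon> / 2)"
      if P: "P \<in> indep_noise_class \<alpha> K p n" and \<theta>: "\<theta> \<in> Theta_res p n s \<rho>" for P \<theta>
    proof -
      interpret noise P p n \<alpha> K
        using P by (intro noise.intro noise_axioms.intro) (simp_all add: indep_noise_class_def)
      have "\<theta> \<in> space (mat_space p n)" using \<theta> by (auto simp: Theta_res_def Theta_at_def)
      moreover have "(\<lambda>x. ennreal (1 - \<phi> x)) \<in> borel_measurable (mat_space p n)"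
        by (intro measurable_compose[OF _ measurable_ennreal] borel_measurable_diff borel_measurable_const \<phi>_borel)
      ultimately have "(\<integral>\<^sup>+x. ennreal (1 - \<phi> x) \<partial>data_law p n \<theta> P)
          = (\<integral>\<^sup>+e. ennreal (1 - \<phi> (mat_add p n \<theta> e)) \<partial>P)"
        by (rule nn_integral_data_law)
      also have "\<dots> = (\<integral>\<^sup>+e. ennreal (if 2 / \<epsilon> \<le> evidence p n (mat_add p n \<theta> e) then 0 else 1) \<partial>P)"
        by (intro nn_integral_cong) (simp add: \<phi>_def)
      also have "\<dots> \<le> ennreal (\<epsilon> / 2)"
        using s by (intro nn_integral_low_evidence_alternative[OF _ _ n assms(4,5) E_def _ \<rho> \<theta>])
          (simp_all add: C_def)
      finally show ?thesis .
    qed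
    ultimately have "worst_case_error (indep_noise_class \<alpha> K p n) p n s \<rho> \<phi> \<le> ennreal (\<epsilon> / 2) + ennreal (\<epsilon> / 2)"
      unfolding worst_case_error_def by (intro add_mono SUP_least)
    also have "\<dots> = ennreal \<epsilon>" using \<open>0 < \<epsilon>\<close> by (subst ennreal_plus[symmetric]) auto
    finally show "worst_case_error (indep_noise_class \<alpha> K p n) p n s \<rho> \<phi> \<le> ennreal \<epsilon>" .
  qed
  ultimately show ?thesis by blast
qed

end
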